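(* Let $\mathcal X_1,\mathcal X_2$ be Polish spaces, $\mu_1\in\mathcal P(\mathcal X_1)$, $\mu_2\in\mathcal P(\mathcal X_2)$, and for $i=1,2$ let $c_i:\mathcal X_i\times\mathcal X_i\to[0,\infty)$ be a continuous cost function with $c_i(x,x)=0$ for all $x\in\mathcal X_i$. Let $\alpha_1,\alpha_2\in\mathcal C$ and suppose that $$\alpha_1(\mathcal T_{c_1}(\mu_1,\nu_1))\le H(\nu_1\mid\mu_1)\quad\forall\nu_1\in\mathcal P(\mathcal X_1),\qquad \alpha_2(\mathcal T_{c_2}(\mu_2,\nu_2))\le H(\nu_2\mid\mu_2)\quad\forall\nu_2\in\mathcal P(\mathcal X_2).$$ Then, on the product space $\mathcal X_1\times\mathcal X_2$, $$(\alpha_1\square\alpha_2)\big(\mathcal T_{c_1\oplus c_2}(\mu_1\otimes\mu_2,\nu)\big)\le H(\nu\mid\mu_1\otimes\mu_2)\quad\forall\nu\in\mathcal P(\mathcal X_1\times\mathcal X_2).$$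
   Context: $\mathcal P(\mathcal X)$ is the set of Borel probability measures on $\mathcal X$. $\mathcal T_c(\mu,\nu)=\inf_\pi\int c(x,y)\,\pi(dx\,dy)\in[0,\infty]$, the infimum over all probability measures $\pi$ on the product with first marginal $\mu$ and second marginal $\nu$. $H(\nu\mid\mu)=\int\log\frac{d\nu}{d\mu}\,d\nu$ if $\nu\ll\mu$ and $+\infty$ otherwise. $\mathcal C$ is the class of all functions $\alpha$ on $[0,\infty)$ with values in $[0,\infty]$ that are convex, increasing (meaning nondecreasing), left continuous, with $\alpha(0)=0$; one sets $\alpha(+\infty)=\lim_{t\to\infty}\alpha(t)$. The cost on $\mathcal X_1\times\mathcal X_2$ is $c_1\oplus c_2\big((x_1,x_2),(y_1,y_2)\big)=c_1(x_1,y_1)+c_2(x_2,y_2)$. The inf-convolution is $\alpha_1\square\alpha_2(t)=\inf\{\alpha_1(t_1)+\alpha_2(t_2):t_1,t_2\ge0,\ t_1+t_2=t\}$, $t\ge0$. *)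

theory Defs
  imports "HOL-Probability.Probability"
begin

definition borel_probs :: "'a::topological_space measure set" where
  "borel_probs = {M. prob_space M \<and> sets M = sets borel}"

definition couplings ::
  "'a::topological_space measure \<Rightarrow> 'b::topological_space measure \<Rightarrow> ('a \<times> 'b) measure set" where
  "couplings \<mu> \<nu> = {\<pi> \<in> borel_probs. distr \<pi> borel fst = \<mu> \<and> distr \<pi> borel snd = \<nu>}"

definition transport_cost ::
  "('a::topological_space \<Rightarrow> 'a \<Rightarrow> real) \<Rightarrow> 'a measure \<Rightarrow> 'a measure \<Rightarrow> ennreal" where
  "transport_cost c \<mu> \<nu> = (INF \<pi>\<in>couplings \<mu> \<nu>. \<integral>\<^sup>+ (x, y). ennreal (c x y) \<partial>\<pi>)"

text \<open>
  \<^term>\<open>KL_divergence\<close> cannot be used directly: it is a Bochner integral, hence real-valued, and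
  it is \<^term>\<open>0::real\<close> when the logarithm of the density is not \<open>\<nu>\<close>-integrable. Here the integral
  of the logarithm is taken in the extended reals, as positive part minus negative part. For
  probability measures the negative part is always finite, so the difference is well defined.
\<close>

definition rel_entropy :: "'a measure \<Rightarrow> 'a measure \<Rightarrow> ereal" where
  "rel_entropy \<nu> \<mu> =
    (if absolutely_continuous \<mu> \<nu>
     then enn2ereal (\<integral>\<^sup>+ x. ennreal (entropy_density (exp 1) \<mu> \<nu> x) \<partial>\<nu>)
        - enn2ereal (\<integral>\<^sup>+ x. ennreal (- entropy_density (exp 1) \<mu> \<nu> x) \<partial>\<nu>)
     else \<infinity>)"

text \<open>
  A function on \<open>[0, \<infinity>)\<close> is represented by a function on \<^typ>\<open>real\<close> of which only the values at
  nonnegative arguments matter. Convexity is spelled out because \<^const>\<open>convex_on\<close> only covers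
  real-valued functions; recall that \<open>0 * \<infinity> = 0\<close> in \<^typ>\<open>ennreal\<close>.
\<close>

definition class_C :: "(real \<Rightarrow> ennreal) set" where
  "class_C = {\<alpha>.
     (\<forall>s\<ge>0. \<forall>t\<ge>0. \<forall>u\<in>{0..1}.
        \<alpha> ((1 - u) * s + u * t) \<le> ennreal (1 - u) * \<alpha> s + ennreal u * \<alpha> t) \<and>
     mono_on {0..} \<alpha> \<and>
     (\<forall>t>0. continuous (at_left t) \<alpha>) \<and>
     \<alpha> 0 = 0}"

definition extend_infty :: "(real \<Rightarrow> ennreal) \<Rightarrow> ennreal \<Rightarrow> ennreal" where
  "extend_infty \<alpha> t = (if t = \<infinity> then Lim at_top \<alpha> else \<alpha> (enn2real t))"

definition inf_convolution ::
  "(real \<Rightarrow> ennreal) \<Rightarrow> (real \<Rightarrow> ennreal) \<Rightarrow> real \<Rightarrow> ennreal" (infixl "\<box>" 70) where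
  "(\<alpha>\<^sub>1 \<box> \<alpha>\<^sub>2) t = Inf {\<alpha>\<^sub>1 t\<^sub>1 + \<alpha>\<^sub>2 t\<^sub>2 | t\<^sub>1 t\<^sub>2. 0 \<le> t\<^sub>1 \<and> 0 \<le> t\<^sub>2 \<and> t\<^sub>1 + t\<^sub>2 = t}"

definition cost_sum ::
  "('a \<Rightarrow> 'a \<Rightarrow> real) \<Rightarrow> ('b \<Rightarrow> 'b \<Rightarrow> real) \<Rightarrow> 'a \<times> 'b \<Rightarrow> 'a \<times> 'b \<Rightarrow> real" (infixl "\<oplus>\<^sub>c" 65) where
  "(c\<^sub>1 \<oplus>\<^sub>c c\<^sub>2) x y = c\<^sub>1 (fst x) (fst y) + c\<^sub>2 (snd x) (snd y)"

end

theory Submission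
  imports Defs
begin

text \<open>
  Let \<open>\<nu>\<close> have finite entropy with respect to \<open>\<mu>\<^sub>1 \<otimes> \<mu>\<^sub>2\<close>, and let \<open>\<nu>\<^sub>1\<close> be its first marginal. The classical
  argument disintegrates \<open>\<nu>\<close> as \<open>\<nu>\<^sub>1(dx) \<nu>\<^sup>x(dy)\<close>, couples \<open>\<mu>\<^sub>1\<close> with \<open>\<nu>\<^sub>1\<close> and, given the endpoint \<open>x\<close>,
  couples \<open>\<mu>\<^sub>2\<close> with \<open>\<nu>\<^sup>x\<close>; the chain rule for entropy and Jensen's inequality for \<open>\<alpha>\<^sub>2\<close> then give the
  claim. This needs a measurable choice, in \<open>x\<close>, of nearly optimal couplings. The proof below replaces
  the disintegration by conditioning on the cells of a finite Borel partition of the first space, so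
  that only finitely many couplings are chosen, and recovers \<open>\<nu>\<close> by refining the partition.

  For a fixed partition, with cells of mass \<open>p\<^sub>j\<close> and conditional second marginals \<open>h\<^sub>j\<close>, the Gibbs
  inequality applied to the density of the partially decoupled measure gives the chain inequality
  \<open>H(\<nu>\<^sub>1 | \<mu>\<^sub>1) + \<Sum>\<^sub>j p\<^sub>j H(h\<^sub>j | \<mu>\<^sub>2) \<le> H(\<nu> | \<mu>\<^sub>1 \<otimes> \<mu>\<^sub>2)\<close> (lemma \<open>entropy_chain\<close>). Glueing nearly optimal
  couplings along the cells (lemma \<open>cellwise_coupling\<close>) produces a coupling of \<open>\<mu>\<^sub>1 \<otimes> \<mu>\<^sub>2\<close> with a measure
  that agrees with \<open>\<nu>\<close> on all sets \<open>A \<times> B\<close> for which \<open>A\<close> is a union of cells. Its cost is at most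
  \<open>T\<^sub>1 + x + \<epsilon>\<close>, where \<open>T\<^sub>1\<close> is the transport cost from \<open>\<mu>\<^sub>1\<close> to \<open>\<nu>\<^sub>1\<close> and, by Jensen's inequality and the
  chain inequality, \<open>\<alpha>\<^sub>1(T\<^sub>1) + \<alpha>\<^sub>2(x) \<le> H(\<nu> | \<mu>\<^sub>1 \<otimes> \<mu>\<^sub>2)\<close>. If \<open>S\<close> is the largest number with
  \<open>\<alpha>\<^sub>1(T\<^sub>1) + \<alpha>\<^sub>2(S) \<le> H(\<nu> | \<mu>\<^sub>1 \<otimes> \<mu>\<^sub>2)\<close>, all these costs are at most \<open>T\<^sub>1 + S + \<epsilon>\<close>, uniformly in the
  partition. Such an \<open>S\<close> exists by left continuity unless \<open>\<alpha>\<^sub>2\<close> vanishes identically, in which case, as for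
  \<open>\<alpha>\<^sub>1\<close>, the inf-convolution is zero and the claim is trivial.

  Taking the partitions generated by more and more sets of a countable basis, the second marginals
  agree with \<open>\<nu>\<close> eventually on each finite intersection of basic rectangles, and
  lemma \<open>coupling_limit\<close>, a form of lower semicontinuity of the transport cost, yields a genuine
  coupling of \<open>\<mu>\<^sub>1 \<otimes> \<mu>\<^sub>2\<close> with \<open>\<nu>\<close> of cost at most \<open>T\<^sub>1 + S + \<epsilon>\<close>. That lemma is proved by recording which
  basic sets contain a point as a sequence of bits, extracting a weak limit on the Cantor space by
  Helly's theorem on the real line, and decoding the limit: since both marginals of the limit are
  the coded marginals, almost every bit sequence is the code of an actual point.
\<close>

section \<open>Sequential compactness of measures on the Cantor space\<close>

abbreviation cantor :: "(nat \<Rightarrow> bool) measure" where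
  "cantor \<equiv> \<Pi>\<^sub>M k\<in>UNIV. count_space UNIV"

definition determined_below :: "nat \<Rightarrow> ((nat \<Rightarrow> bool) \<Rightarrow> 'a) \<Rightarrow> bool" where
  "determined_below m \<psi> \<longleftrightarrow> (\<forall>\<omega> \<omega>'. (\<forall>k<m. \<omega> k = \<omega>' k) \<longrightarrow> \<psi> \<omega> = \<psi> \<omega>')"

lemma space_cantor: "space cantor = UNIV"
  by (simp add: space_PiM)

text \<open>
  A function of the first \<open>m\<close> bits takes one value for each subset of \<open>{..<m}\<close>. Expanding it over these
  subsets yields measurability and boundedness at once.
\<close>

lemma determined_below_sum:
  fixes \<psi> :: "(nat \<Rightarrow> bool) \<Rightarrow> real"
  assumes "determined_below m \<psi>"
  shows "\<psi> \<omega> = (\<Sum>S\<in>Pow {..<m}. \<psi> (\<lambda>k. k \<in> S) * of_bool (\<forall>k<m. \<omega> k \<longleftrightarrow> k \<in> S))"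
proof -
  have *: "(\<forall>k<m. \<omega> k \<longleftrightarrow> k \<in> S) \<longleftrightarrow> S = {k. k < m \<and> \<omega> k}" if "S \<in> Pow {..<m}" for S
    using that by auto
  have "(\<Sum>S\<in>Pow {..<m}. \<psi> (\<lambda>k. k \<in> S) * of_bool (\<forall>k<m. \<omega> k \<longleftrightarrow> k \<in> S))
      = (\<Sum>S\<in>Pow {..<m}. if S = {k. k < m \<and> \<omega> k} then \<psi> (\<lambda>k. k \<in> S) else 0)"
    by (intro sum.cong refl) (simp add: * del: Pow_iff)
  also have "\<dots> = \<psi> (\<lambda>k. k \<in> {k. k < m \<and> \<omega> k})"
    by (subst sum.delta) (auto simp del: mem_Collect_eq)
  also have "\<dots> = \<psi> \<omega>"
    using assms unfolding determined_below_def by fastforce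
  finally show ?thesis by simp
qed

lemma determined_below_measurable:
  fixes \<psi> :: "(nat \<Rightarrow> bool) \<Rightarrow> real"
  assumes "determined_below m \<psi>"
  shows "\<psi> \<in> borel_measurable cantor"
  by (subst determined_below_sum[OF assms, abs_def]) measurable

lemma determined_below_bounded:
  fixes \<psi> :: "(nat \<Rightarrow> bool) \<Rightarrow> real"
  assumes "determined_below m \<psi>"
  shows "\<exists>C. \<forall>\<omega>. \<bar>\<psi> \<omega>\<bar> \<le> C"
proof (intro exI allI)
  fix \<omega>
  show "\<bar>\<psi> \<omega>\<bar> \<le> (\<Sum>S\<in>Pow {..<m}. \<bar>\<psi> (\<lambda>k. k \<in> S)\<bar>)"
    by (subst determined_below_sum[OF assms]) (rule order.trans[OF sum_abs], auto intro!: sum_mono)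
qed

text \<open>
  The Cantor space is embedded into the real line by reading bits as base-four digits. As only the
  digits 0 and 1 occur, \<open>4 ^ Suc n * base4 \<omega>\<close> always lies within \<open>1/3\<close> above an integer whose parity is
  the bit \<open>n\<close>. The shift by \<open>1/2\<close> in \<open>digit\<close> therefore reads the bit off at a point where the floor
  function does not jump.
\<close>

definition base4 :: "(nat \<Rightarrow> bool) \<Rightarrow> real" where
  "base4 \<omega> = (\<Sum>k. of_bool (\<omega> k) * (1/4) ^ Suc k)"

definition digit :: "nat \<Rightarrow> real \<Rightarrow> bool" where
  "digit n r \<longleftrightarrow> odd \<lfloor>4 ^ Suc n * r + 1/2\<rfloor>"

lemma base4_summable: "summable (\<lambda>k. of_bool (\<omega> (k + j)) * (1/4::real) ^ Suc k)"
  by (rule summable_comparison_test'[of "\<lambda>k. (1/4::real) ^ Suc k" 0])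
     (auto simp: summable_Suc_iff intro!: summable_mult)

lemma base4_tail:
  "(\<Sum>k. of_bool (\<omega> (k + j)) * (1/4::real) ^ Suc k) \<in> {0..1/3}"
proof -
  have g: "(\<lambda>k. (1/4::real) ^ Suc k) sums (1/3)"
    using sums_mult[OF geometric_sums[of "1/4::real"], of "1/4"] by simp
  have "(\<Sum>k. of_bool (\<omega> (k + j)) * (1/4::real) ^ Suc k) \<le> (\<Sum>k. (1/4::real) ^ Suc k)"
    by (intro suminf_le base4_summable sums_summable[OF g]) auto
  also have "\<dots> = 1/3" using g by (rule sums_unique[symmetric])
  finally show ?thesis
    using suminf_nonneg[OF base4_summable[of \<omega> j]] by simp
qed

lemma base4_bounds: "base4 \<omega> \<in> {0..1/3}"
  using base4_tail[of \<omega> 0] by (simp add: base4_def)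

lemma base4_scaled:
  "\<exists>N::int. \<exists>t\<in>{0..1/3}. 4 ^ Suc n * base4 \<omega> = of_int (2 * N + of_bool (\<omega> n)) + t"
proof -
  define t where "t = (\<Sum>k. of_bool (\<omega> (k + Suc n)) * (1/4::real) ^ Suc k)"
  define N :: int where "N = (\<Sum>i<n. of_bool (\<omega> i) * 2 * 4 ^ (n - i - 1))"
  have "base4 \<omega> = (\<Sum>k. of_bool (\<omega> (k + Suc n)) * (1/4) ^ Suc (k + Suc n))
      + (\<Sum>i<Suc n. of_bool (\<omega> i) * (1/4) ^ Suc i)"
    unfolding base4_def
    by (rule suminf_split_initial_segment) (use base4_summable[of \<omega> 0] in simp)
  also have "(\<Sum>k. of_bool (\<omega> (k + Suc n)) * (1/4::real) ^ Suc (k + Suc n)) = (1/4) ^ Suc n * t"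
    unfolding t_def
    by (subst suminf_mult[symmetric, OF base4_summable]) (simp add: power_add mult_ac)
  finally have "4 ^ Suc n * base4 \<omega> = t + 4 ^ Suc n * (\<Sum>i<Suc n. of_bool (\<omega> i) * (1/4) ^ Suc i)"
    by (simp add: distrib_left power_divide)
  also have "4 ^ Suc n * (\<Sum>i<Suc n. of_bool (\<omega> i) * (1/4) ^ Suc i)
      = (\<Sum>i<n. of_bool (\<omega> i) * (4::real) ^ (n - i)) + of_bool (\<omega> n)"
    by (auto simp: distrib_left sum_distrib_left power_divide power_diff field_simps intro!: sum.cong)
  also have "(\<Sum>i<n. of_bool (\<omega> i) * (4::real) ^ (n - i)) = of_int (2 * N)"
  proof -
    have "(4::real) ^ (n - i) = 2 * (2 * 4 ^ (n - i - 1))" if "i < n" for i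
    proof -
      from that have "n - i = Suc (n - i - 1)" by auto
      then have "(4::real) ^ (n - i) = 4 * 4 ^ (n - i - 1)" by (metis power_Suc)
      then show ?thesis by simp
    qed
    then have eq: "of_bool (\<omega> i) * (4::real) ^ (n - i) = 2 * (of_bool (\<omega> i) * 2 * 4 ^ (n - i - 1))"
      if "i < n" for i
      using that by (simp only: mult_ac)
    show ?thesis unfolding N_def sum_distrib_left of_int_sum
      by (intro sum.cong refl, subst eq) simp_all
  qed
  finally show ?thesis using base4_tail[of \<omega> "Suc n"] unfolding t_def
    by (intro exI[of _ N] bexI[of _ t]) (auto simp: t_def)
qed

lemma digit_base4: "digit n (base4 \<omega>) = \<omega> n"
proof -
  obtain N t where t: "t \<in> {0..1/3::real}"
    "4 ^ Suc n * base4 \<omega> = of_int (2 * N + of_bool (\<omega> n)) + t"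
    using base4_scaled by blast
  have "\<lfloor>4 ^ Suc n * base4 \<omega> + 1/2\<rfloor> = 2 * N + of_bool (\<omega> n)"
    unfolding t using t(1) by (intro floor_unique) auto
  then show ?thesis unfolding digit_def by simp
qed

lemma base4_measurable[measurable]: "base4 \<in> borel_measurable cantor"
  unfolding base4_def[abs_def] by measurable

lemma digit_measurable[measurable]: "Measurable.pred borel (digit n)"
  unfolding digit_def[abs_def] by measurable

lemma digits_measurable: "(\<lambda>r n. digit n r) \<in> borel \<rightarrow>\<^sub>M cantor"
  by (rule measurable_PiM_single') (auto simp: space_PiM)

text \<open>
  The jump points of \<open>digit n\<close> keep a positive distance from all of the embedded Cantor set. Hence no
  weak limit of measures on that set can charge them, although the limit may have atoms.
\<close>

lemma base4_away:
  assumes "4 ^ Suc n * d + 1/2 \<in> \<int>"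
  shows "\<bar>base4 \<omega> - d\<bar> \<ge> 1 / 4 ^ Suc n / 8"
proof -
  obtain N t where t: "t \<in> {0..1/3::real}"
    "4 ^ Suc n * base4 \<omega> = of_int (2 * N + of_bool (\<omega> n)) + t"
    using base4_scaled by blast
  obtain K where K: "4 ^ Suc n * d + 1/2 = of_int K" using assms by (auto elim: Ints_cases)
  define L where "L = 2 * N + of_bool (\<omega> n) - K"
  have "4 ^ Suc n * (base4 \<omega> - d) = of_int L + (t + 1/2)"
    unfolding L_def using t K by (simp add: algebra_simps)
  moreover have "L \<le> -1 \<or> L \<ge> 0" by linarith
  then have "real_of_int L \<le> -1 \<or> real_of_int L \<ge> 0" by linarith
  then have "\<bar>of_int L + (t + 1/2)\<bar> \<ge> 1/8" using t(1) by auto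
  ultimately have "\<bar>4 ^ Suc n * (base4 \<omega> - d)\<bar> \<ge> 1/8" by simp
  then have "4 ^ Suc n * \<bar>base4 \<omega> - d\<bar> \<ge> 1/8" by (simp add: abs_mult)
  then show ?thesis by (simp add: field_simps)
qed

lemma digit_locally_constant:
  assumes "4 ^ Suc n * r + 1/2 \<notin> \<int>"
  shows "eventually (\<lambda>s. digit n s = digit n r) (at r)"
proof -
  have "eventually (\<lambda>s. \<lfloor>4 ^ Suc n * s + 1/2\<rfloor> = \<lfloor>4 ^ Suc n * r + 1/2\<rfloor>) (at r)"
    by (rule eventually_floor_eq) (use assms in \<open>auto intro!: tendsto_intros\<close>)
  then show ?thesis by eventually_elim (simp add: digit_def)
qed

text \<open>
  Under the embedding by \<open>base4\<close> every sequence of measures is tight on the real line, so Helly's theorem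
  gives a weakly convergent subsequence. Functions of finitely many bits become almost everywhere
  continuous functions of the real number, so that their integrals converge.
\<close>

lemma cantor_sequentially_compact:
  fixes P :: "nat \<Rightarrow> (nat \<Rightarrow> bool) measure"
  assumes P: "\<And>n. prob_space (P n)" and sP[measurable_cong]: "\<And>n. sets (P n) = sets cantor"
  obtains s Q where "strict_mono (s :: nat \<Rightarrow> nat)" "prob_space Q" "sets Q = sets cantor"
    "\<And>m (\<psi> :: _ \<Rightarrow> real). determined_below m \<psi> \<Longrightarrow>
      (\<lambda>n. \<integral>\<omega>. \<psi> \<omega> \<partial>P (s n)) \<longlonglongrightarrow> (\<integral>\<omega>. \<psi> \<omega> \<partial>Q)"
proof -
  define R where "R n = distr (P n) borel base4" for n
  have b4[measurable]: "base4 \<in> borel_measurable (P n)" for n by measurable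
  have R: "real_distribution (R n)" for n
    unfolding R_def using prob_space.real_distribution_distr[OF P] by simp
  have "tight R"
    unfolding tight_def
  proof (intro conjI allI impI)
    fix e :: real assume "e > 0"
    have "measure (R n) {-1<..1} = 1" for n
    proof -
      have "base4 -` {-1<..1} \<inter> space (P n) = space (P n)"
      proof -
        have "base4 \<omega> \<in> {-1<..1}" for \<omega> using base4_bounds[of \<omega>] by auto
        then show ?thesis by auto
      qed
      then show ?thesis unfolding R_def
        using prob_space.prob_space[OF P] by (subst measure_distr) auto
    qed
    then show "\<exists>a b. a < b \<and> (\<forall>n. 1 - e < measure (R n) {a<..b})"
      using \<open>e > 0\<close> by (intro exI[of _ "-1"] exI[of _ 1]) auto
  qed (use R in auto)
  then obtain s M where s: "strict_mono s" and M: "real_distribution M"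
    and conv: "weak_conv_m (\<lambda>n. R (s n)) M"
    using tight_imp_convergent_subsubsequence[of R id]
    by (auto simp: strict_mono_id comp_def)
  interpret M: real_distribution M by fact
  \<comment> \<open>A bump function around a jump point vanishes on the embedded Cantor set.\<close>
  have null: "emeasure M {d} = 0" if d: "4 ^ Suc n * d + 1/2 \<in> \<int>" for n d
  proof -
    define \<delta> :: real where "\<delta> = 1 / 4 ^ Suc n / 8"
    have \<delta>: "\<delta> > 0" by (simp add: \<delta>_def)
    define g where "g r = max 0 (1 - \<bar>r - d\<bar> / \<delta>)" for r
    have g: "isCont g x" "norm (g x) \<le> 1" for x
      unfolding g_def using \<delta> by (auto intro!: continuous_intros)
    have [measurable]: "g \<in> borel_measurable borel"
      using g by (auto intro!: borel_measurable_continuous_onI continuous_at_imp_continuous_on)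
    have "(\<lambda>n. integral\<^sup>L (R (s n)) g) \<longlonglongrightarrow> integral\<^sup>L M g"
      by (rule weak_conv_imp_integral_bdd_continuous_conv[OF R M conv g])
    moreover have "integral\<^sup>L (R (s n)) g = 0" for n
    proof -
      have "g (base4 \<omega>) = 0" for \<omega>
        using base4_away[OF d, of \<omega>] \<delta> by (simp add: g_def \<delta>_def field_simps max_def)
      then show ?thesis unfolding R_def by (subst integral_distr) auto
    qed
    ultimately have "integral\<^sup>L M g = 0" by (simp add: LIMSEQ_const_iff)
    moreover have int: "integrable M g"
      using g by (intro M.integrable_const_bound[of _ 1]) auto
    moreover have "measure M {d} = (\<integral>r. indicator {d} r \<partial>M)" by simp
    moreover have "\<dots> \<le> integral\<^sup>L M g"
      by (intro integral_mono int M.integrable_const_bound[of _ 1])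
         (auto simp: g_def indicator_def)
    ultimately have "measure M {d} = 0" by (simp add: measure_le_0_iff)
    then show ?thesis by (simp add: M.emeasure_eq_measure)
  qed
  define Q where "Q = distr M cantor (\<lambda>r n. digit n r)"
  have dm[measurable]: "(\<lambda>r n. digit n r) \<in> M \<rightarrow>\<^sub>M cantor"
    using digits_measurable by measurable
  show thesis
  proof
    show "strict_mono s" by fact
    show "prob_space Q" unfolding Q_def by (rule M.prob_space_distr) measurable
    show "sets Q = sets cantor" by (simp add: Q_def)
    fix m and \<psi> :: "(nat \<Rightarrow> bool) \<Rightarrow> real" assume \<psi>: "determined_below m \<psi>"
    note [measurable] = determined_below_measurable[OF \<psi>] digits_measurable
    obtain C where C: "\<And>\<omega>. \<bar>\<psi> \<omega>\<bar> \<le> C" using determined_below_bounded[OF \<psi>] by blast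
    let ?f = "\<lambda>r. \<psi> (\<lambda>n. digit n r)"
    have sub: "{r. \<not> isCont ?f r} \<subseteq> (\<Union>k\<in>{..<m}. {r. 4 ^ Suc k * r + 1/2 \<in> \<int>})"
    proof (rule ccontr)
      assume "\<not> ?thesis"
      then obtain r where r: "\<not> isCont ?f r" "\<And>k. k < m \<Longrightarrow> 4 ^ Suc k * r + 1/2 \<notin> \<int>" by blast
      have "eventually (\<lambda>s. \<forall>k\<in>{..<m}. digit k s = digit k r) (at r)"
        using digit_locally_constant[OF r(2)] by (intro eventually_ball_finite) auto
      then have "eventually (\<lambda>s. ?f s = ?f r) (at r)"
        by eventually_elim (use \<psi> in \<open>auto simp: determined_below_def\<close>)
      then have "isCont ?f r" unfolding isCont_def by (rule tendsto_eventually)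
      with r show False by simp
    qed
    have N: "(\<Union>k\<in>{..<m}. {r. 4 ^ Suc k * r + 1/2 \<in> \<int>}) \<in> null_sets M"
    proof (intro null_sets_UN')
      fix k
      have "{r::real. 4 ^ Suc k * r + 1/2 \<in> \<int>} = (\<Union>z::int. {(of_int z - 1/2) / 4 ^ Suc k})"
        by (auto simp: Ints_def field_simps)
      also have "\<dots> \<in> null_sets M"
      proof (intro null_sets_UN)
        fix z :: int
        have "4 ^ Suc k * ((of_int z - 1/2) / 4 ^ Suc k) + 1/2 = (of_int z :: real)" by simp
        then have "4 ^ Suc k * ((of_int z - 1/2) / 4 ^ Suc k) + 1/2 \<in> (\<int> :: real set)"
          by (metis Ints_of_int)
        from null[OF this] show "{(of_int z - 1/2) / 4 ^ Suc k} \<in> null_sets M" by auto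
      qed
      finally show "{r. 4 ^ Suc k * r + 1/2 \<in> \<int>} \<in> null_sets M" .
    qed auto
    have "emeasure M {r. \<not> isCont ?f r} = 0"
      using emeasure_mono[OF sub null_setsD2[OF N]] null_setsD1[OF N] by simp
    then have "(\<lambda>n. integral\<^sup>L (R (s n)) ?f) \<longlonglongrightarrow> integral\<^sup>L M ?f"
      using C by (intro weak_conv_imp_bdd_ae_continuous_conv[OF R M conv, where B=C]) auto
    moreover have "integral\<^sup>L (R n) ?f = integral\<^sup>L (P n) \<psi>" for n
      unfolding R_def by (subst integral_distr) (auto simp: digit_base4)
    moreover have "integral\<^sup>L M ?f = integral\<^sup>L Q \<psi>"
      unfolding Q_def by (subst integral_distr) auto
    ultimately show "(\<lambda>n. \<integral>\<omega>. \<psi> \<omega> \<partial>P (s n)) \<longlonglongrightarrow> (\<integral>\<omega>. \<psi> \<omega> \<partial>Q)" by simp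
  qed
qed

text \<open>
  The sets on which finitely many given bits are all true form a generator closed under intersection.
  Consequently the law of the code of a random point is determined by the probabilities of finite
  intersections of basic open sets.
\<close>

lemma cantor_measure_eqI:
  assumes P: "prob_space P" "sets P = sets cantor" and Q: "prob_space Q" "sets Q = sets cantor"
    and eq: "\<And>J. finite J \<Longrightarrow> measure P {\<omega>. \<forall>k\<in>J. \<omega> k} = measure Q {\<omega>. \<forall>k\<in>J. \<omega> k}"
  shows "P = Q"
proof -
  interpret P: prob_space P by fact
  interpret Q: prob_space Q by fact
  let ?G = "(\<lambda>J. {\<omega>::nat \<Rightarrow> bool. \<forall>k\<in>J. \<omega> k}) ` {J. finite J}"
  have gen: "sets cantor = sigma_sets UNIV ?G"
  proof
    have "sets cantor \<subseteq> sets (sigma UNIV ?G)"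
    proof (rule sets_PiM_in_sets)
      fix k :: nat and A :: "bool set"
      have T: "{\<omega>. \<omega> k} \<in> sets (sigma UNIV ?G)"
        by (auto intro!: sigma_sets.Basic image_eqI[of _ _ "{k}"])
      have "{\<omega>. \<omega> k \<in> A} = (if True \<in> A then {\<omega>. \<omega> k} else {}) \<union> (if False \<in> A then UNIV - {\<omega>. \<omega> k} else {})"
        by (auto split: if_splits) (metis (full_types))+
      moreover have "UNIV - {\<omega>. \<omega> k} \<in> sets (sigma UNIV ?G)"
        using sets.compl_sets[OF T] by (simp add: space_measure_of_conv)
      ultimately show "{x \<in> space (sigma UNIV ?G). x k \<in> A} \<in> sets (sigma UNIV ?G)"
        using T by (auto simp: space_measure_of_conv intro: sigma_sets.Empty)
    qed (auto simp: space_measure_of_conv)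
    then show "sets cantor \<subseteq> sigma_sets UNIV ?G" by simp
    have "{\<omega>. \<forall>k\<in>J. \<omega> k} \<in> sets cantor" if "finite J" for J :: "nat set"
    proof -
      have "{\<omega>\<in>space cantor. \<forall>k\<in>J. \<omega> k} \<in> sets cantor" using that by measurable
      then show ?thesis by (simp add: space_cantor)
    qed
    then show "sigma_sets UNIV ?G \<subseteq> sets cantor"
      using sets.sigma_sets_subset[of ?G cantor] by (auto simp: space_cantor)
  qed
  show ?thesis
  proof (rule measure_eqI_generator_eq[where E = ?G and \<Omega> = UNIV and A = "\<lambda>_. UNIV"])
    show "Int_stable ?G"
      unfolding Int_stable_def
    proof (clarify)
      fix J K :: "nat set" assume "finite J" "finite K"
      moreover have "{\<omega>. \<forall>k\<in>J. \<omega> k} \<inter> {\<omega>. \<forall>k\<in>K. \<omega> k} = {\<omega>. \<forall>k\<in>J\<union>K. \<omega> k}" by auto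
      ultimately show "{\<omega>. \<forall>k\<in>J. \<omega> k} \<inter> {\<omega>. \<forall>k\<in>K. \<omega> k} \<in> ?G" by blast
    qed
    show "range (\<lambda>_::nat. UNIV) \<subseteq> ?G" by (auto intro!: image_eqI[of _ _ "{}"])
  qed (use P Q gen eq in \<open>auto simp: P.emeasure_eq_measure Q.emeasure_eq_measure\<close>)
qed

section \<open>Coding the points of a Polish space by bit sequences\<close>

lemma fst_borel[measurable]:
  "fst \<in> (borel :: ('a::second_countable_topology \<times> 'b::second_countable_topology) measure) \<rightarrow>\<^sub>M borel"
  unfolding borel_prod[symmetric] by measurable

lemma snd_borel[measurable]:
  "snd \<in> (borel :: ('a::second_countable_topology \<times> 'b::second_countable_topology) measure) \<rightarrow>\<^sub>M borel"
  unfolding borel_prod[symmetric] by measurable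

definition code :: "(nat \<Rightarrow> 'x set) \<Rightarrow> 'x \<Rightarrow> nat \<Rightarrow> bool" where
  "code V x k \<longleftrightarrow> x \<in> V k"

definition center :: "(nat \<Rightarrow> 'x set) \<Rightarrow> nat \<Rightarrow> 'x" where
  "center V k = (SOME x. x \<in> V k)"

text \<open>
  A bit sequence is decoded by successive approximation: at precision \<open>1 / 2 ^ m\<close> one takes the center of
  the first set that is marked by the sequence and is that small. For the code of a point \<open>x\<close> this center
  is within \<open>1 / 2 ^ m\<close> of \<open>x\<close>; for other sequences the approximations may fail to converge, and \<open>decode\<close>
  then has a fixed default value.
\<close>

definition approx_point :: "(nat \<Rightarrow> 'x::metric_space set) \<Rightarrow> nat \<Rightarrow> (nat \<Rightarrow> bool) \<Rightarrow> 'x" where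
  "approx_point V m \<omega> = center V (LEAST k. \<omega> k \<and> V k \<subseteq> ball (center V k) (1 / 2 ^ m))"

definition decode :: "(nat \<Rightarrow> 'x::metric_space set) \<Rightarrow> (nat \<Rightarrow> bool) \<Rightarrow> 'x" where
  "decode V \<omega> = lim (\<lambda>m. if Cauchy (\<lambda>m. approx_point V m \<omega>) then approx_point V m \<omega> else undefined)"

lemma approx_point_code:
  assumes "topological_basis (range V)"
  shows "dist (approx_point V m (code V x)) x < 1 / 2 ^ m"
proof -
  let ?P = "\<lambda>k. x \<in> V k \<and> V k \<subseteq> ball (center V k) (1 / 2 ^ m)"
  obtain B where "B \<in> range V" "x \<in> B" "B \<subseteq> ball x (1 / 2 ^ Suc m)"
    by (rule topological_basisE[OF assms open_ball, of x x "1 / 2 ^ Suc m"]) auto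
  then obtain k where k: "x \<in> V k" "V k \<subseteq> ball x (1 / 2 ^ Suc m)" by auto
  have "center V k \<in> V k" unfolding center_def using k(1) by (rule someI)
  have "V k \<subseteq> ball (center V k) (1 / 2 ^ m)"
  proof
    fix y assume "y \<in> V k"
    with k \<open>center V k \<in> V k\<close> have "dist x y < 1 / 2 ^ Suc m" "dist x (center V k) < 1 / 2 ^ Suc m"
      by auto
    then show "y \<in> ball (center V k) (1 / 2 ^ m)"
      using dist_triangle3[of "center V k" y x] by auto
  qed
  with k(1) have "?P k" by simp
  then have "?P (LEAST k. ?P k)" by (rule LeastI)
  then show ?thesis by (auto simp: approx_point_def code_def)
qed

lemma decode_code:
  fixes V :: "nat \<Rightarrow> 'x::metric_space set"
  assumes "topological_basis (range V)"
  shows "decode V (code V x) = x"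
proof -
  have "(\<lambda>m. approx_point V m (code V x)) \<longlonglongrightarrow> x"
  proof (rule metric_tendsto_imp_tendsto[of "\<lambda>m. 1 / 2 ^ m" "0::real"])
    show "(\<lambda>m. 1 / 2 ^ m :: real) \<longlonglongrightarrow> 0"
      using LIMSEQ_power_zero[of "1/2::real"] by (simp add: power_divide)
    show "\<forall>\<^sub>F m in sequentially. dist (approx_point V m (code V x)) x \<le> dist (1 / 2 ^ m :: real) 0"
      using less_imp_le[OF approx_point_code[OF assms]] by (intro always_eventually) simp
  qed
  moreover from this have "Cauchy (\<lambda>m. approx_point V m (code V x))"
    by (rule LIMSEQ_imp_Cauchy)
  ultimately show ?thesis unfolding decode_def by (simp add: limI)
qed

lemma approx_point_measurable[measurable]: "approx_point V m \<in> borel_measurable cantor"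
  unfolding approx_point_def[abs_def]
proof (rule measurable_compose[where N = "count_space UNIV" and g = "center V"])
  show "(\<lambda>\<omega>. LEAST k. \<omega> k \<and> V k \<subseteq> ball (center V k) (1 / 2 ^ m)) \<in> cantor \<rightarrow>\<^sub>M count_space UNIV"
  proof (rule measurable_Least)
    fix k
    show "(\<lambda>\<omega>. \<omega> k \<and> V k \<subseteq> ball (center V k) (1 / 2 ^ m)) \<in> cantor \<rightarrow>\<^sub>M count_space UNIV"
      by (cases "V k \<subseteq> ball (center V k) (1 / 2 ^ m)") (simp_all add: measurable_component_singleton)
  qed
qed simp

text \<open>
  Decoding is a Borel map on the whole Cantor space, as a pointwise limit of maps with countably many
  values. Together with the coding map it makes the Polish space a Borel retract of the Cantor space.
\<close>

lemma decode_measurable[measurable]: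
  fixes V :: "nat \<Rightarrow> 'x::{complete_space, second_countable_topology} set"
  shows "decode V \<in> borel_measurable cantor"
proof -
  let ?f = "\<lambda>m \<omega>. if Cauchy (\<lambda>m. approx_point V m \<omega>) then approx_point V m \<omega> else undefined"
  have [measurable]: "Measurable.pred cantor (\<lambda>\<omega>. Cauchy (\<lambda>m. approx_point V m \<omega>))"
    unfolding pred_def by (rule sets_Collect_Cauchy) measurable
  show ?thesis
  proof (rule borel_measurable_LIMSEQ_metric)
    show "?f m \<in> borel_measurable cantor" for m by measurable
    fix \<omega>
    have "convergent (\<lambda>m. ?f m \<omega>)"
      by (cases "Cauchy (\<lambda>m. approx_point V m \<omega>)") (auto simp: Cauchy_convergent_iff convergent_const)
    then show "(\<lambda>m. ?f m \<omega>) \<longlonglongrightarrow> decode V \<omega>"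
      unfolding decode_def by (simp only: convergent_LIMSEQ_iff)
  qed
qed

lemma code_measurable:
  assumes "topological_basis (range V)"
  shows "code V \<in> borel \<rightarrow>\<^sub>M cantor"
proof (rule measurable_PiM_single')
  fix k
  have [measurable]: "V k \<in> sets borel"
    using topological_basis_open[OF assms, of "V k"] by simp
  show "(\<lambda>x. code V x k) \<in> borel \<rightarrow>\<^sub>M count_space UNIV" unfolding code_def by measurable
qed (simp add: space_PiM)

section \<open>Limits of couplings\<close>

text \<open>
  Lower semicontinuity of the transport cost along couplings whose marginals converge on all finite
  intersections of sets of a countable basis. A limit exists on the Cantor space of codes. Its two
  marginals are determined by those intersections, so they are the laws of the codes of \<open>\<mu>\<close> and \<open>\<nu>\<close>; in
  particular almost every bit sequence is the code of a pair of points, and decoding gives a coupling.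
  The cost passes to the limit because a continuous cost is the increasing limit of its infima over the
  cells of the first \<open>m\<close> bits, and these infima depend on finitely many bits only.
\<close>

lemma coupling_limit:
  fixes V :: "nat \<Rightarrow> 'x::{complete_space, second_countable_topology} set"
    and \<mu> \<nu> :: "'x measure" and \<pi> :: "nat \<Rightarrow> ('x \<times> 'x) measure" and c :: "'x \<Rightarrow> 'x \<Rightarrow> real"
  assumes V: "topological_basis (range V)"
    and \<mu>: "\<mu> \<in> borel_probs" and \<nu>: "\<nu> \<in> borel_probs" and \<pi>: "\<And>n. \<pi> n \<in> borel_probs"
    and conv1: "\<And>J. finite J \<Longrightarrow>
      (\<lambda>n. measure (\<pi> n) {z. \<forall>k\<in>J. fst z \<in> V k}) \<longlonglongrightarrow> measure \<mu> {x. \<forall>k\<in>J. x \<in> V k}"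
    and conv2: "\<And>J. finite J \<Longrightarrow>
      (\<lambda>n. measure (\<pi> n) {z. \<forall>k\<in>J. snd z \<in> V k}) \<longlonglongrightarrow> measure \<nu> {x. \<forall>k\<in>J. x \<in> V k}"
    and c: "continuous_on UNIV (\<lambda>(x, y). c x y)" and c0: "\<And>x y. c x y \<ge> 0"
    and t: "\<And>n. (\<integral>\<^sup>+ (x, y). ennreal (c x y) \<partial>\<pi> n) \<le> t"
  shows "\<exists>\<rho>\<in>couplings \<mu> \<nu>. (\<integral>\<^sup>+ (x, y). ennreal (c x y) \<partial>\<rho>) \<le> t"
proof -
  have V_borel[measurable]: "V k \<in> sets borel" for k
    using topological_basis_open[OF V, of "V k"] by simp
  have \<pi>P: "prob_space (\<pi> n)" and \<pi>S[measurable_cong]: "sets (\<pi> n) = sets borel" for n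
    using \<pi> by (auto simp: borel_probs_def)
  have \<pi>Sp[simp]: "space (\<pi> n) = UNIV" for n using sets_eq_imp_space_eq[OF \<pi>S[of n]] by simp
  have c_meas[measurable]: "(\<lambda>(x, y). c x y) \<in> borel_measurable borel"
    by (rule borel_measurable_continuous_onI[OF c])
  \<comment> \<open>The codes of the two coordinates of a pair are interleaved: even positions belong to the first.\<close>
  define E where "E z k = (if even k then code V (fst z) (k div 2) else code V (snd z) (k div 2))"
    for z :: "'x \<times> 'x" and k
  have E_k[measurable]: "Measurable.pred borel (\<lambda>z. E z k)" for k
    unfolding E_def code_def by measurable
  have E[measurable]: "E \<in> borel \<rightarrow>\<^sub>M cantor"
    by (rule measurable_PiM_single') (auto simp: space_PiM)
  define P where "P n = distr (\<pi> n) cantor E" for n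
  have P: "prob_space (P n)" "sets (P n) = sets cantor" for n
    unfolding P_def by (auto intro!: prob_space.prob_space_distr \<pi>P)
  obtain s Q where s: "strict_mono (s :: nat \<Rightarrow> nat)" and Q: "prob_space Q"
    and QS[measurable_cong]: "sets Q = sets cantor"
    and lim: "\<And>m (\<psi> :: _ \<Rightarrow> real). determined_below m \<psi> \<Longrightarrow>
      (\<lambda>n. \<integral>\<omega>. \<psi> \<omega> \<partial>P (s n)) \<longlonglongrightarrow> (\<integral>\<omega>. \<psi> \<omega> \<partial>Q)"
    by (rule cantor_sequentially_compact[where P = P, OF P]) (rule that)
  interpret Q: prob_space Q by fact
  have QSp[simp]: "space Q = UNIV" using sets_eq_imp_space_eq[OF QS] by (simp add: space_cantor)
  have lim': "(\<lambda>n. \<integral>z. \<psi> (E z) \<partial>\<pi> (s n)) \<longlonglongrightarrow> (\<integral>\<omega>. \<psi> \<omega> \<partial>Q)"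
    if "determined_below m \<psi>" for m and \<psi> :: "_ \<Rightarrow> real"
  proof -
    note [measurable] = determined_below_measurable[OF that]
    have "(\<integral>\<omega>. \<psi> \<omega> \<partial>P n) = (\<integral>z. \<psi> (E z) \<partial>\<pi> n)" for n
      unfolding P_def by (rule integral_distr) measurable
    then show ?thesis using lim[OF that] by simp
  qed

  have marginal: "distr Q cantor (\<lambda>\<omega> k. \<omega> (2 * k + i)) = distr \<kappa> cantor (code V)"
    if \<kappa>: "\<kappa> \<in> borel_probs" and i: "i \<le> Suc 0"
      and E_h: "\<And>z k. E z (2 * k + i) \<longleftrightarrow> h z \<in> V k"
      and h[measurable]: "h \<in> borel \<rightarrow>\<^sub>M (borel :: 'x measure)"
      and conv: "\<And>J. finite J \<Longrightarrow>
        (\<lambda>n. measure (\<pi> n) {z. \<forall>k\<in>J. h z \<in> V k}) \<longlonglongrightarrow> measure \<kappa> {x. \<forall>k\<in>J. x \<in> V k}"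
    for \<kappa> :: "'x measure" and i and h :: "'x \<times> 'x \<Rightarrow> 'x"
  proof (rule cantor_measure_eqI)
    have \<kappa>P: "prob_space \<kappa>" and \<kappa>S[measurable_cong]: "sets \<kappa> = sets borel"
      using \<kappa> by (auto simp: borel_probs_def)
    have \<kappa>Sp: "space \<kappa> = UNIV" using sets_eq_imp_space_eq[OF \<kappa>S] by simp
    have cd[measurable]: "code V \<in> \<kappa> \<rightarrow>\<^sub>M cantor" using code_measurable[OF V] by measurable
    have sel[measurable]: "(\<lambda>\<omega> k. \<omega> (2 * k + i)) \<in> Q \<rightarrow>\<^sub>M cantor"
      by (rule measurable_PiM_single') (auto simp: space_PiM)
    show "prob_space (distr Q cantor (\<lambda>\<omega> k. \<omega> (2 * k + i)))" by (rule Q.prob_space_distr) measurable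
    show "prob_space (distr \<kappa> cantor (code V))" by (rule prob_space.prob_space_distr[OF \<kappa>P]) measurable
    fix J :: "nat set" assume J: "finite J"
    obtain b where b: "\<And>k. k \<in> J \<Longrightarrow> k \<le> b"
      using J by (auto simp: finite_nat_set_iff_bounded_le)
    define m where "m = Suc (2 * b + i)"
    let ?\<psi> = "\<lambda>\<omega>. of_bool (\<forall>k\<in>J. \<omega> (2 * k + i)) :: real"
    have "2 * k + i < m" if "k \<in> J" for k
      using b[OF that] by (simp add: m_def)
    then have det: "determined_below m ?\<psi>"
      unfolding determined_below_def of_bool_eq_iff by blast
    have cyl[measurable]: "{\<omega>. \<forall>k\<in>J. \<omega> k} \<in> sets cantor"
    proof -
      have "{\<omega>\<in>space cantor. \<forall>k\<in>J. \<omega> k} \<in> sets cantor" using J by measurable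
      then show ?thesis by (simp add: space_cantor)
    qed
    have "measure (distr Q cantor (\<lambda>\<omega> k. \<omega> (2 * k + i))) {\<omega>. \<forall>k\<in>J. \<omega> k}
        = measure Q {\<omega>. \<forall>k\<in>J. \<omega> (2 * k + i)}"
      by (subst measure_distr) (auto intro!: arg_cong2[where f=measure])
    also have "\<dots> = (\<integral>\<omega>. indicator {\<omega>. \<forall>k\<in>J. \<omega> (2 * k + i)} \<omega> \<partial>Q)"
      by simp
    also have "\<dots> = (\<integral>\<omega>. ?\<psi> \<omega> \<partial>Q)"
      by (intro Bochner_Integration.integral_cong) (auto simp: indicator_def)
    finally have 1: "measure (distr Q cantor (\<lambda>\<omega> k. \<omega> (2 * k + i))) {\<omega>. \<forall>k\<in>J. \<omega> k} = (\<integral>\<omega>. ?\<psi> \<omega> \<partial>Q)" .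
    have "(\<integral>z. ?\<psi> (E z) \<partial>\<pi> n) = measure (\<pi> n) {z. \<forall>k\<in>J. h z \<in> V k}" for n
    proof -
      have "(\<integral>z. ?\<psi> (E z) \<partial>\<pi> n) = (\<integral>z. indicator {z. \<forall>k\<in>J. h z \<in> V k} z \<partial>\<pi> n)"
        by (intro Bochner_Integration.integral_cong) (auto simp: indicator_def E_h)
      then show ?thesis by simp
    qed
    then have "(\<lambda>n. \<integral>z. ?\<psi> (E z) \<partial>\<pi> (s n)) \<longlonglongrightarrow> measure \<kappa> {x. \<forall>k\<in>J. x \<in> V k}"
      using LIMSEQ_subseq_LIMSEQ[OF conv[OF J] s] by (simp add: comp_def)
    with lim'[OF det] have "(\<integral>\<omega>. ?\<psi> \<omega> \<partial>Q) = measure \<kappa> {x. \<forall>k\<in>J. x \<in> V k}"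
      by (rule LIMSEQ_unique)
    moreover have "measure (distr \<kappa> cantor (code V)) {\<omega>. \<forall>k\<in>J. \<omega> k} = measure \<kappa> {x. \<forall>k\<in>J. x \<in> V k}"
      by (subst measure_distr) (auto simp: \<kappa>Sp code_def intro!: arg_cong2[where f=measure])
    ultimately show "measure (distr Q cantor (\<lambda>\<omega> k. \<omega> (2 * k + i))) {\<omega>. \<forall>k\<in>J. \<omega> k}
        = measure (distr \<kappa> cantor (code V)) {\<omega>. \<forall>k\<in>J. \<omega> k}" using 1 by simp
  qed (auto)
  have m1: "distr Q cantor (\<lambda>\<omega> k. \<omega> (2 * k + 0)) = distr \<mu> cantor (code V)"
    by (rule marginal[OF \<mu>, of 0 fst]) (auto simp: E_def code_def intro: conv1)
  have m2: "distr Q cantor (\<lambda>\<omega> k. \<omega> (2 * k + 1)) = distr \<nu> cantor (code V)"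
    by (rule marginal[OF \<nu>, of 1 snd]) (auto simp: E_def code_def intro: conv2)

  have sel[measurable]: "(\<lambda>\<omega> k. \<omega> (2 * k + i)) \<in> Q \<rightarrow>\<^sub>M cantor" for i
    by (rule measurable_PiM_single') (auto simp: space_PiM)
  define D where "D i \<omega> = decode V (\<lambda>k. \<omega> (2 * k + i))" for i \<omega>
  have D[measurable]: "D i \<in> borel_measurable Q" for i
    unfolding D_def[abs_def] by (rule measurable_compose[OF sel decode_measurable])
  have D_marginal: "distr Q borel (D i) = \<kappa>" "AE \<omega> in Q. code V (D i \<omega>) = (\<lambda>k. \<omega> (2 * k + i))"
    if \<kappa>: "\<kappa> \<in> borel_probs" and eq: "distr Q cantor (\<lambda>\<omega> k. \<omega> (2 * k + i)) = distr \<kappa> cantor (code V)"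
    for i and \<kappa> :: "'x measure"
  proof -
    have \<kappa>S[measurable_cong]: "sets \<kappa> = sets borel"
      using \<kappa> by (auto simp: borel_probs_def)
    have cd[measurable]: "code V \<in> \<kappa> \<rightarrow>\<^sub>M cantor" using code_measurable[OF V] by measurable
    have "distr Q borel (D i) = distr (distr Q cantor (\<lambda>\<omega> k. \<omega> (2 * k + i))) borel (decode V)"
      by (subst distr_distr) (auto simp: D_def[abs_def] comp_def)
    also have "\<dots> = distr \<kappa> borel (\<lambda>x. x)"
      unfolding eq by (subst distr_distr) (auto simp: comp_def decode_code[OF V])
    also have "\<dots> = \<kappa>" using distr_id2[of borel \<kappa>] \<kappa>S by simp
    finally show "distr Q borel (D i) = \<kappa>" .
    have pr: "Measurable.pred cantor (\<lambda>\<omega>. \<forall>k. decode V \<omega> \<in> V k \<longleftrightarrow> \<omega> k)" by measurable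
    have "AE \<omega> in distr \<kappa> cantor (code V). \<forall>k. decode V \<omega> \<in> V k \<longleftrightarrow> \<omega> k"
      by (subst AE_distr_iff) (use pr in \<open>auto simp: pred_def decode_code[OF V] code_def\<close>)
    then have "AE \<omega> in Q. \<forall>k. D i \<omega> \<in> V k \<longleftrightarrow> \<omega> (2 * k + i)"
      unfolding eq[symmetric] D_def by (subst (asm) AE_distr_iff) (use pr in \<open>auto simp: pred_def\<close>)
    then show "AE \<omega> in Q. code V (D i \<omega>) = (\<lambda>k. \<omega> (2 * k + i))"
      by eventually_elim (auto simp: code_def)
  qed
  \<comment> \<open>Almost surely the limit bit sequence is the code of the pair it decodes to.\<close>
  have good: "AE \<omega> in Q. E (D 0 \<omega>, D 1 \<omega>) = \<omega>"
    using D_marginal(2)[OF \<mu> m1] D_marginal(2)[OF \<nu> m2]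
  proof eventually_elim
    case (elim \<omega>)
    have "E (D 0 \<omega>, D 1 \<omega>) k = \<omega> k" for k
    proof (cases "even k")
      case True
      then show ?thesis using fun_cong[OF elim(1), of "k div 2"] by (simp add: E_def)
    next
      case False
      then show ?thesis using fun_cong[OF elim(2), of "k div 2"] by (simp add: E_def)
    qed
    then show ?case by blast
  qed
  define Dp where "Dp \<omega> = (D 0 \<omega>, D 1 \<omega>)" for \<omega>
  have Dp[measurable]: "Dp \<in> borel_measurable Q"
    unfolding Dp_def[abs_def] by measurable
  define \<rho> where "\<rho> = distr Q borel Dp"
  have "\<rho> \<in> couplings \<mu> \<nu>"
    unfolding couplings_def borel_probs_def
  proof (intro CollectI conjI)
    show "prob_space \<rho>" unfolding \<rho>_def by (rule Q.prob_space_distr) measurable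
    show "sets \<rho> = sets borel" by (simp add: \<rho>_def)
    have "distr \<rho> borel fst = distr Q borel (D 0)" "distr \<rho> borel snd = distr Q borel (D 1)"
      unfolding \<rho>_def by (subst distr_distr; simp add: comp_def Dp_def)+
    then show "distr \<rho> borel fst = \<mu>" "distr \<rho> borel snd = \<nu>"
      using D_marginal(1)[OF \<mu> m1] D_marginal(1)[OF \<nu> m2] by auto
  qed

  define c' where "c' z = c (fst z) (snd z)" for z
  have c'0: "c' z \<ge> 0" for z by (simp add: c'_def c0)
  have c'_eq: "(\<lambda>(x, y). ennreal (c x y)) = (\<lambda>z. ennreal (c' z))" by (auto simp: c'_def)
  have c'_cont: "continuous_on UNIV c'" using c by (simp add: c'_def[abs_def] case_prod_beta')
  have c'_meas[measurable]: "c' \<in> borel_measurable borel"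
    by (rule borel_measurable_continuous_onI[OF c'_cont])
  define cell where "cell m \<omega> = {z. \<forall>k<m. E z k = \<omega> k}" for m \<omega>
  \<comment> \<open>A bit pattern may belong to no pair of points; such patterns get the harmless value 0.\<close>
  define low where "low m \<omega> = (if cell m \<omega> = {} then 0 else Inf (c' ` cell m \<omega>))" for m \<omega>
  have low_det: "determined_below m (low m)" for m
    unfolding determined_below_def
  proof (intro allI impI)
    fix \<omega> \<omega>' :: "nat \<Rightarrow> bool" assume "\<forall>k<m. \<omega> k = \<omega>' k"
    then have "cell m \<omega> = cell m \<omega>'" by (auto simp: cell_def)
    then show "low m \<omega> = low m \<omega>'" by (simp add: low_def)
  qed
  note [measurable] = determined_below_measurable[OF low_det]
  have bdd: "bdd_below (c' ` A)" for A using c'0 by (intro bdd_belowI[of _ 0]) auto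
  have low0: "low m \<omega> \<ge> 0" for m \<omega>
    unfolding low_def using c'0 by (auto intro!: cInf_greatest)
  have low_le: "low m (E z) \<le> c' z" for m z
  proof -
    have "z \<in> cell m (E z)" by (simp add: cell_def)
    then show ?thesis unfolding low_def by (auto intro!: cInf_lower bdd)
  qed
  have low_lim: "(\<lambda>m. low m (E z)) \<longlonglongrightarrow> c' z" for z
  proof (rule tendstoI)
    fix e :: real assume e: "e > 0"
    have "open {z'. c' z - e / 2 < c' z'}"
      by (rule open_Collect_less[OF _ c'_cont]) (auto intro: continuous_intros)
    moreover have "z \<in> {z'. c' z - e / 2 < c' z'}" using e by simp
    ultimately obtain A B where AB: "open A" "open B" "z \<in> A \<times> B" "A \<times> B \<subseteq> {z'. c' z - e / 2 < c' z'}"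
      by (rule open_prod_elim)
    have "fst z \<in> A" "snd z \<in> B" using AB(3) by auto
    obtain U where U: "U \<in> range V" "fst z \<in> U" "U \<subseteq> A"
      using topological_basisE[OF V AB(1) \<open>fst z \<in> A\<close>] .
    obtain U' where U': "U' \<in> range V" "snd z \<in> U'" "U' \<subseteq> B"
      using topological_basisE[OF V AB(2) \<open>snd z \<in> B\<close>] .
    from U U' obtain i j where ij: "fst z \<in> V i" "V i \<subseteq> A" "snd z \<in> V j" "V j \<subseteq> B" by auto
    show "\<forall>\<^sub>F m in sequentially. dist (low m (E z)) (c' z) < e"
      using eventually_gt_at_top[of "2 * i + (2 * j + 1)"]
    proof eventually_elim
      case (elim m)
      have "c' z - e / 2 \<le> c' z'" if "z' \<in> cell m (E z)" for z'
      proof -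
        from that elim have "E z' (2 * i) = E z (2 * i)" "E z' (2 * j + 1) = E z (2 * j + 1)"
          by (auto simp: cell_def)
        with ij have "z' \<in> A \<times> B" by (cases z') (auto simp: E_def code_def)
        with AB show ?thesis by auto
      qed
      moreover have "z \<in> cell m (E z)" by (simp add: cell_def)
      ultimately have "c' z - e / 2 \<le> low m (E z)"
        unfolding low_def by (auto intro!: cInf_greatest)
      with low_le[of m z] e show ?case by (auto simp: dist_real_def)
    qed
  qed
  have low_int: "(\<integral>\<^sup>+\<omega>. ennreal (low m \<omega>) \<partial>Q) \<le> t" for m
  proof -
    obtain C where C: "\<And>\<omega>. \<bar>low m \<omega>\<bar> \<le> C" using determined_below_bounded[OF low_det] by blast
    have "integrable Q (low m)"
      using C by (intro Q.integrable_const_bound[of _ C]) auto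
    then have "(\<integral>\<^sup>+\<omega>. ennreal (low m \<omega>) \<partial>Q) = ennreal (\<integral>\<omega>. low m \<omega> \<partial>Q)"
      using low0 by (intro nn_integral_eq_integral) auto
    moreover have "ennreal (\<integral>z. low m (E z) \<partial>\<pi> n) \<le> t" for n
    proof -
      interpret prob_space "\<pi> n" by (rule \<pi>P)
      have "integrable (\<pi> n) (\<lambda>z. low m (E z))"
        using C by (intro integrable_const_bound[of _ C]) auto
      then have "ennreal (\<integral>z. low m (E z) \<partial>\<pi> n) = (\<integral>\<^sup>+z. ennreal (low m (E z)) \<partial>\<pi> n)"
        using low0 by (intro nn_integral_eq_integral[symmetric]) auto
      also have "\<dots> \<le> (\<integral>\<^sup>+z. ennreal (c' z) \<partial>\<pi> n)"
        using low_le by (intro nn_integral_mono ennreal_leI) auto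
      also have "\<dots> \<le> t" using t[of n] by (simp add: c'_eq)
      finally show ?thesis .
    qed
    ultimately show ?thesis
      using LIMSEQ_le_const2[OF tendsto_ennrealI[OF lim'[OF low_det]]] by auto
  qed
  have "(\<integral>\<^sup>+ (x, y). ennreal (c x y) \<partial>\<rho>) = (\<integral>\<^sup>+\<omega>. ennreal (c' (Dp \<omega>)) \<partial>Q)"
    unfolding c'_eq \<rho>_def by (rule nn_integral_distr) measurable
  also have "\<dots> = (\<integral>\<^sup>+\<omega>. liminf (\<lambda>m. ennreal (low m \<omega>)) \<partial>Q)"
  proof (rule nn_integral_cong_AE, use good in eventually_elim)
    case (elim \<omega>)
    then have "(\<lambda>m. ennreal (low m \<omega>)) \<longlonglongrightarrow> ennreal (c' (Dp \<omega>))"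
      using tendsto_ennrealI[OF low_lim[of "Dp \<omega>"]] by (simp add: Dp_def)
    then show ?case by (intro lim_imp_Liminf[symmetric]) auto
  qed
  also have "\<dots> \<le> liminf (\<lambda>m. \<integral>\<^sup>+\<omega>. ennreal (low m \<omega>) \<partial>Q)"
    by (rule nn_integral_liminf) measurable
  also have "\<dots> \<le> t"
    by (rule Liminf_le) (auto intro!: always_eventually low_int)
  finally show ?thesis using \<open>\<rho> \<in> couplings \<mu> \<nu>\<close> by blast
qed

section \<open>Relative entropy\<close>

lemma RN_deriv_real_density:
  assumes M: "prob_space M" and N: "prob_space N" and s: "sets N = sets M"
    and ac: "absolutely_continuous M N"
  shows "density M (\<lambda>x. ennreal (enn2real (RN_deriv M N x))) = N"
    and "AE x in N. enn2real (RN_deriv M N x) > 0"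
proof -
  interpret M: prob_space M by fact
  interpret N: prob_space N by fact
  have fin: "AE x in M. RN_deriv M N x \<noteq> \<infinity>"
    by (rule M.RN_deriv_finite[OF N.sigma_finite_measure ac s])
  have "density M (\<lambda>x. ennreal (enn2real (RN_deriv M N x))) = density M (RN_deriv M N)"
    by (intro density_cong) (use fin in \<open>auto elim!: AE_mp simp: top.not_eq_extremum\<close>)
  also have "\<dots> = N" by (rule M.density_RN_deriv[OF ac s])
  finally show d: "density M (\<lambda>x. ennreal (enn2real (RN_deriv M N x))) = N" .
  have "AE x in density M (\<lambda>x. ennreal (enn2real (RN_deriv M N x))). enn2real (RN_deriv M N x) > 0"
    by (subst AE_density) auto
  then show "AE x in N. enn2real (RN_deriv M N x) > 0" by (simp only: d)
qed

lemma entropy_density_eq: "entropy_density (exp 1) M N x = ln (enn2real (RN_deriv M N x))"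
  by (simp add: entropy_density_def log_def)

text \<open>
  Integrating \<open>F / d\<close> against the measure with density \<open>d\<close> returns the integral of \<open>F\<close> over the set where
  \<open>d\<close> is positive. With \<open>ln t \<le> t - 1\<close> this is the source of every entropy bound below.
\<close>

lemma nn_integral_quotient_le:
  assumes M: "prob_space M" and N: "prob_space N" and s: "sets N = sets M"
    and ac: "absolutely_continuous M N" and F[measurable]: "F \<in> borel_measurable M"
    and F0: "\<And>x. (F x :: real) \<ge> 0"
  shows "(\<integral>\<^sup>+x. ennreal (F x / enn2real (RN_deriv M N x)) \<partial>N) \<le> (\<integral>\<^sup>+x. ennreal (F x) \<partial>M)"
proof -
  let ?d = "\<lambda>x. enn2real (RN_deriv M N x)"
  have "(\<integral>\<^sup>+x. ennreal (F x / ?d x) \<partial>N)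
      = (\<integral>\<^sup>+x. ennreal (F x / ?d x) \<partial>density M (\<lambda>x. ennreal (?d x)))"
    by (simp add: RN_deriv_real_density(1)[OF M N s ac])
  also have "\<dots> = (\<integral>\<^sup>+x. ennreal (?d x) * ennreal (F x / ?d x) \<partial>M)"
    by (intro nn_integral_density) measurable
  also have "\<dots> \<le> (\<integral>\<^sup>+x. ennreal (F x) \<partial>M)"
    by (intro nn_integral_mono) (auto simp: ennreal_mult'[symmetric] F0 intro!: ennreal_leI)
  finally show ?thesis .
qed

lemma entropy_density_neg_part:
  assumes M: "prob_space M" and N: "prob_space N" and s: "sets N = sets M"
    and ac: "absolutely_continuous M N"
  shows "(\<integral>\<^sup>+x. ennreal (- entropy_density (exp 1) M N x) \<partial>N) \<le> 1"
proof -
  have "(\<integral>\<^sup>+x. ennreal (- entropy_density (exp 1) M N x) \<partial>N)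
      \<le> (\<integral>\<^sup>+x. ennreal (1 / enn2real (RN_deriv M N x)) \<partial>N)"
  proof (rule nn_integral_mono_AE, use RN_deriv_real_density(2)[OF M N s ac] in eventually_elim)
    case (elim x)
    then show ?case
      using ln_le_minus_one[of "1 / enn2real (RN_deriv M N x)"]
      by (auto simp: entropy_density_eq ln_div intro!: ennreal_leI)
  qed
  also have "\<dots> \<le> (\<integral>\<^sup>+x. ennreal 1 \<partial>M)"
    using nn_integral_quotient_le[OF M N s ac, of "\<lambda>_. 1"] by simp
  also have "\<dots> = 1" using prob_space.emeasure_space_1[OF M] by simp
  finally show ?thesis .
qed

text \<open>
  The negative part of the logarithmic density always has integral at most 1. Hence, given absolute
  continuity, finite entropy is the same as finiteness of the positive part, and then the difference of extended reals in the definition is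
  an ordinary integral.
\<close>

lemma rel_entropy_finite_iff:
  assumes M: "prob_space M" and N: "prob_space N" and s[measurable_cong]: "sets N = sets M"
  shows "rel_entropy N M < \<infinity> \<longleftrightarrow>
    absolutely_continuous M N \<and> (\<integral>\<^sup>+x. ennreal (entropy_density (exp 1) M N x) \<partial>N) < \<infinity>"
    and "rel_entropy N M < \<infinity> \<Longrightarrow> integrable N (entropy_density (exp 1) M N)"
    and "rel_entropy N M < \<infinity> \<Longrightarrow>
      rel_entropy N M = ereal (\<integral>x. entropy_density (exp 1) M N x \<partial>N)"
proof -
  let ?e = "entropy_density (exp 1) M N"
  let ?p = "\<integral>\<^sup>+x. ennreal (?e x) \<partial>N" and ?n = "\<integral>\<^sup>+x. ennreal (- ?e x) \<partial>N"
  have n: "?n < \<infinity>" if "absolutely_continuous M N"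
    using entropy_density_neg_part[OF M N s that] by (simp add: order_le_less_trans)
  show iff: "rel_entropy N M < \<infinity> \<longleftrightarrow> absolutely_continuous M N \<and> ?p < \<infinity>"
  proof (cases "absolutely_continuous M N")
    case True
    with n[OF True] show ?thesis
      unfolding rel_entropy_def by (cases ?p; cases ?n) (auto simp: )
  qed (auto simp: rel_entropy_def)
  assume fin: "rel_entropy N M < \<infinity>"
  with iff have ac: "absolutely_continuous M N" and p: "?p < \<infinity>" by auto
  have [measurable]: "?e \<in> borel_measurable N" by measurable
  show "integrable N ?e" unfolding real_integrable_def using p n[OF ac] by auto
  then have "(\<integral>x. ?e x \<partial>N) = enn2real ?p - enn2real ?n" by (rule real_lebesgue_integral_def)
  with p n[OF ac] show "rel_entropy N M = ereal (\<integral>x. ?e x \<partial>N)"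
    unfolding rel_entropy_def using ac by (cases ?p; cases ?n) auto
qed

text \<open>
  Among all subprobability densities \<open>F\<close> the true density \<open>d\<close> of \<open>N\<close> maximizes the expectation of \<open>ln F\<close>
  under \<open>N\<close>: this is \<open>ln F \<le> ln d + F / d - 1\<close>, integrated. The same estimate bounds the positive part of
  \<open>ln F\<close>, so integrability has to be checked for the negative part only.
\<close>

lemma Gibbs_inequality:
  assumes M: "prob_space M" and N: "prob_space N" and s[measurable_cong]: "sets N = sets M"
    and fin: "rel_entropy N M < \<infinity>"
    and F[measurable]: "F \<in> borel_measurable M" and F1: "(\<integral>\<^sup>+x. ennreal (F x) \<partial>M) \<le> 1"
    and F0: "\<And>x. F x \<ge> 0" and Fpos: "AE x in N. F x > (0::real)"
  shows "(\<integral>\<^sup>+x. ennreal (ln (F x)) \<partial>N) < \<infinity>"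
    and "integrable N (\<lambda>x. ln (F x)) \<Longrightarrow> ereal (\<integral>x. ln (F x) \<partial>N) \<le> rel_entropy N M"
proof -
  interpret N: prob_space N by fact
  let ?d = "\<lambda>x. enn2real (RN_deriv M N x)" and ?e = "entropy_density (exp 1) M N"
  have ac: "absolutely_continuous M N" using fin rel_entropy_finite_iff(1)[OF M N s] by auto
  note e = rel_entropy_finite_iff(2,3)[OF M N s fin]
  have q: "(\<integral>\<^sup>+x. ennreal (F x / ?d x) \<partial>N) \<le> 1"
    using nn_integral_quotient_le[OF M N s ac F F0] F1 by simp
  have [measurable]: "?d \<in> borel_measurable N" "?e \<in> borel_measurable N" by measurable
  have qi: "integrable N (\<lambda>x. F x / ?d x)"
    using q F0 by (intro integrableI_nonneg) (auto intro: order_le_less_trans)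
  have "ennreal (\<integral>x. F x / ?d x \<partial>N) \<le> 1"
    using q F0 by (subst nn_integral_eq_integral[OF qi, symmetric]) auto
  then have q1: "(\<integral>x. F x / ?d x \<partial>N) \<le> 1" by simp
  have le: "AE x in N. ln (F x) \<le> ?e x + F x / ?d x - 1"
    using RN_deriv_real_density(2)[OF M N s ac] Fpos
  proof eventually_elim
    case (elim x)
    then show ?case
      using ln_le_minus_one[of "F x / ?d x"] by (auto simp: entropy_density_eq ln_div)
  qed
  have "(\<integral>\<^sup>+x. ennreal (ln (F x)) \<partial>N) \<le> (\<integral>\<^sup>+x. ennreal (norm (?e x + F x / ?d x)) \<partial>N)"
    by (rule nn_integral_mono_AE, use le in eventually_elim) (auto intro!: ennreal_leI)
  also have "\<dots> < \<infinity>"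
    using Bochner_Integration.integrable_add[OF e(1) qi] by (simp add: integrable_iff_bounded)
  finally show "(\<integral>\<^sup>+x. ennreal (ln (F x)) \<partial>N) < \<infinity>" .
  assume "integrable N (\<lambda>x. ln (F x))"
  then have "(\<integral>x. ln (F x) \<partial>N) \<le> (\<integral>x. ?e x + F x / ?d x - 1 \<partial>N)"
    using le e(1) qi by (intro integral_mono_AE) auto
  also have "\<dots> = (\<integral>x. ?e x \<partial>N) + (\<integral>x. F x / ?d x \<partial>N) - 1"
    using e(1) qi by (simp add: N.prob_space)
  also have "\<dots> \<le> (\<integral>x. ?e x \<partial>N)" using q1 by simp
  finally show "ereal (\<integral>x. ln (F x) \<partial>N) \<le> rel_entropy N M" by (simp add: e(2))
qed

lemma rel_entropy_nonneg:
  assumes M: "prob_space M" and N: "prob_space N" and s: "sets N = sets M"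
  shows "0 \<le> rel_entropy N M"
proof (cases "rel_entropy N M < \<infinity>")
  case True
  show ?thesis
    using Gibbs_inequality(2)[OF M N s True, of "\<lambda>_. 1"] prob_space.emeasure_space_1[OF M]
    by (simp add: zero_ereal_def)
qed simp

text \<open>
  The cells \<open>i x = j\<close> have mass \<open>p j\<close> under \<open>N\<close>, and \<open>h j\<close> is the second marginal of \<open>N\<close> conditioned on the cell.
  Let \<open>f\<close> be the density of the first marginal and \<open>k j\<close> that of \<open>h j\<close>. Then \<open>F (x, y) = f x * k (i x) y\<close> is the
  density of the measure that keeps the first marginal of \<open>N\<close> and draws \<open>y\<close> given only the cell of \<open>x\<close>.
  The left-hand side is the \<open>N\<close>-expectation of \<open>ln F\<close>, and the Gibbs inequality applies.
\<close>

lemma entropy_chain: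
  fixes i :: "'a \<Rightarrow> nat" and p :: "nat \<Rightarrow> real" and h :: "nat \<Rightarrow> 'b measure"
  assumes M1: "prob_space M1" and M2: "prob_space M2"
    and N: "prob_space N" and s[measurable_cong]: "sets N = sets (M1 \<Otimes>\<^sub>M M2)"
    and fin: "rel_entropy N (M1 \<Otimes>\<^sub>M M2) < \<infinity>"
    and i[measurable]: "i \<in> M1 \<rightarrow>\<^sub>M count_space UNIV" and J: "finite J"
    and iJ: "AE z in N. i (fst z) \<in> J"
    and p: "\<And>j. j \<in> J \<Longrightarrow> p j > 0"
    and h: "\<And>j. j \<in> J \<Longrightarrow> prob_space (h j)"
    and hs: "\<And>j. j \<in> J \<Longrightarrow> sets (h j) = sets M2"
    and hN: "\<And>j B. j \<in> J \<Longrightarrow> B \<in> sets M2 \<Longrightarrow>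
      emeasure N ({x\<in>space M1. i x = j} \<times> B) = ennreal (p j) * emeasure (h j) B"
  shows "rel_entropy (distr N M1 fst) M1 < \<infinity>"
    and "\<And>j. j \<in> J \<Longrightarrow> rel_entropy (h j) M2 < \<infinity>"
    and "rel_entropy (distr N M1 fst) M1 + (\<Sum>j\<in>J. ereal (p j) * rel_entropy (h j) M2)
      \<le> rel_entropy N (M1 \<Otimes>\<^sub>M M2)"
proof -
  interpret M1: prob_space M1 by fact
  interpret M2: prob_space M2 by fact
  interpret P: pair_prob_space M1 M2 ..
  interpret N: prob_space N by fact
  have sp: "space N = space M1 \<times> space M2"
    using sets_eq_imp_space_eq[OF s] by (simp add: space_pair_measure)
  note h = h and hs[measurable_cong] = hs
  have hsp: "space (h j) = space M2" if "j \<in> J" for j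
    using sets_eq_imp_space_eq[OF hs[OF that]] .
  define N1 where "N1 = distr N M1 fst"
  have N1: "prob_space N1" "sets N1 = sets M1"
    unfolding N1_def by (auto intro!: N.prob_space_distr)
  note [measurable_cong] = N1(2)
  have acN: "absolutely_continuous (M1 \<Otimes>\<^sub>M M2) N"
    using fin rel_entropy_finite_iff(1)[OF P.prob_space_axioms N s] by auto
  have ac1: "absolutely_continuous M1 N1"
    unfolding absolutely_continuous_def
  proof
    fix A assume A: "A \<in> null_sets M1"
    then have [measurable]: "A \<in> sets M1" by auto
    have "emeasure (M1 \<Otimes>\<^sub>M M2) (A \<times> space M2) = 0"
      using A by (subst M2.emeasure_pair_measure_Times) auto
    then have "A \<times> space M2 \<in> null_sets (M1 \<Otimes>\<^sub>M M2)" by (intro null_setsI) auto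
    then have "A \<times> space M2 \<in> null_sets N"
      using acN by (auto simp: absolutely_continuous_def)
    moreover have "emeasure N1 A = emeasure N (A \<times> space M2)"
      unfolding N1_def using sets.sets_into_space[of A M1]
      by (subst emeasure_distr) (auto simp: sp intro!: arg_cong[where f="emeasure N"])
    ultimately show "A \<in> null_sets N1" by (auto simp: null_sets_def N1(2))
  qed
  have ac2: "absolutely_continuous M2 (h j)" if j: "j \<in> J" for j
    unfolding absolutely_continuous_def
  proof
    fix B assume B: "B \<in> null_sets M2"
    then have [measurable]: "B \<in> sets M2" by auto
    have "emeasure (M1 \<Otimes>\<^sub>M M2) ({x\<in>space M1. i x = j} \<times> B) = 0"
      using B by (subst M2.emeasure_pair_measure_Times) auto
    then have "{x\<in>space M1. i x = j} \<times> B \<in> null_sets (M1 \<Otimes>\<^sub>M M2)" by (intro null_setsI) auto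
    then have "{x\<in>space M1. i x = j} \<times> B \<in> null_sets N"
      using acN by (auto simp: absolutely_continuous_def)
    with hN[OF j, of B] p[OF j] show "B \<in> null_sets (h j)"
      by (auto simp: null_sets_def hs[OF j])
  qed
  define f where "f x = enn2real (RN_deriv M1 N1 x)" for x
  define k where "k j y = enn2real (RN_deriv M2 (h j) y)" for j y
  have [measurable]: "f \<in> borel_measurable M1" "k j \<in> borel_measurable M2" for j
    unfolding f_def[abs_def] k_def[abs_def] by measurable
  note f = RN_deriv_real_density[OF M1 N1 ac1, folded f_def]
  have k: "density M2 (\<lambda>y. ennreal (k j y)) = h j" "AE y in h j. k j y > 0" if j: "j \<in> J" for j
    using RN_deriv_real_density[OF M2 h[OF j] hs[OF j] ac2[OF j]] by (simp_all add: k_def)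
  define I where "I j x = (of_bool (i x = j) :: real)" for j x
  have [measurable]: "I j \<in> borel_measurable M1" for j
    unfolding I_def[abs_def] by measurable
  have I0: "I j x \<ge> 0" for j x by (simp add: I_def)
  define F where "F z = f (fst z) * (\<Sum>j\<in>J. I j (fst z) * k j (snd z))" for z
  have F_meas[measurable]: "F \<in> borel_measurable (M1 \<Otimes>\<^sub>M M2)"
    unfolding F_def by measurable
  have f0: "f x \<ge> 0" and k0: "k j y \<ge> 0" for x j y by (simp_all add: f_def k_def)
  have F0: "F z \<ge> 0" for z unfolding F_def using f0 k0 I0 by (auto intro!: mult_nonneg_nonneg sum_nonneg)
  \<comment> \<open>Restricting \<open>N\<close> to a cell and projecting to the second coordinate gives \<open>p j\<close> times \<open>h j\<close>.\<close>
  have restrict: "distr (density N (\<lambda>z. ennreal (I j (fst z)))) M2 snd = density (h j) (\<lambda>_. ennreal (p j))"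
    if j: "j \<in> J" for j
  proof (rule measure_eqI)
    fix B assume "B \<in> sets (distr (density N (\<lambda>z. ennreal (I j (fst z)))) M2 snd)"
    then have [measurable]: "B \<in> sets M2" by simp
    have "emeasure (distr (density N (\<lambda>z. ennreal (I j (fst z)))) M2 snd) B
        = (\<integral>\<^sup>+z. ennreal (I j (fst z)) * indicator (snd -` B \<inter> space N) z \<partial>N)"
      by (subst emeasure_distr) (auto simp: emeasure_density)
    also have "\<dots> = (\<integral>\<^sup>+z. indicator ({x\<in>space M1. i x = j} \<times> B) z \<partial>N)"
      by (intro nn_integral_cong) (auto simp: indicator_def I_def sp)
    also have "\<dots> = ennreal (p j) * emeasure (h j) B"
      by (subst nn_integral_indicator) (auto simp: hN[OF j])
    also have "\<dots> = emeasure (density (h j) (\<lambda>_. ennreal (p j))) B"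
      using j by (subst emeasure_density) (auto simp: nn_integral_cmult hs)
    finally show "emeasure (distr (density N (\<lambda>z. ennreal (I j (fst z)))) M2 snd) B
        = emeasure (density (h j) (\<lambda>_. ennreal (p j))) B" .
  qed (simp add: hs j)
  have restrict_nn: "(\<integral>\<^sup>+z. ennreal (I j (fst z)) * g (snd z) \<partial>N) = ennreal (p j) * (\<integral>\<^sup>+y. g y \<partial>h j)"
    if j: "j \<in> J" and g[measurable]: "g \<in> borel_measurable M2" for j and g :: "'b \<Rightarrow> ennreal"
  proof -
    have [measurable]: "g \<in> borel_measurable (h j)"
      using g by (simp add: measurable_cong_sets[OF hs[OF j] refl])
    have "(\<integral>\<^sup>+z. ennreal (I j (fst z)) * g (snd z) \<partial>N)
        = (\<integral>\<^sup>+y. g y \<partial>distr (density N (\<lambda>z. ennreal (I j (fst z)))) M2 snd)"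
      by (subst nn_integral_distr) (auto simp: nn_integral_density)
    also have "\<dots> = ennreal (p j) * (\<integral>\<^sup>+y. g y \<partial>h j)"
      unfolding restrict[OF j] by (subst nn_integral_density) (auto simp: nn_integral_cmult)
    finally show ?thesis .
  qed
  have one: "(\<Sum>j\<in>J. I j x * g j) = g (i x)" if "i x \<in> J" for x and g :: "nat \<Rightarrow> real"
  proof -
    have "(\<Sum>j\<in>J. I j x * g j) = (\<Sum>j\<in>J. if j = i x then g j else 0)"
      by (intro sum.cong) (auto simp: I_def)
    then show ?thesis using J that by simp
  qed

  have "(\<integral>\<^sup>+z. ennreal (F z) \<partial>(M1 \<Otimes>\<^sub>M M2))
      = (\<Sum>j\<in>J. \<integral>\<^sup>+z. ennreal (f (fst z) * I j (fst z)) * ennreal (k j (snd z)) \<partial>(M1 \<Otimes>\<^sub>M M2))"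
    unfolding F_def sum_distrib_left
    using f0 k0 I0 
    by (subst nn_integral_sum[symmetric])
       (auto simp: sum_ennreal ennreal_mult'[symmetric] mult.assoc intro!: nn_integral_cong)
  also have "\<dots> = (\<Sum>j\<in>J. \<integral>\<^sup>+x. ennreal (f x * I j x) \<partial>M1)"
  proof (intro sum.cong refl)
    fix j assume j: "j \<in> J"
    have k1: "(\<integral>\<^sup>+y. ennreal (k j y) \<partial>M2) = 1"
    proof -
      have "(\<integral>\<^sup>+y. ennreal (k j y) \<partial>M2) = emeasure (density M2 (\<lambda>y. ennreal (k j y))) (space M2)"
        by (subst emeasure_density) (auto intro!: nn_integral_cong)
      also have "\<dots> = 1"
        using prob_space.emeasure_space_1[OF h[OF j]] by (simp add: k(1)[OF j] hsp[OF j])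
      finally show ?thesis .
    qed
    show "(\<integral>\<^sup>+z. ennreal (f (fst z) * I j (fst z)) * ennreal (k j (snd z)) \<partial>(M1 \<Otimes>\<^sub>M M2))
        = (\<integral>\<^sup>+x. ennreal (f x * I j x) \<partial>M1)"
      by (subst M2.nn_integral_fst[symmetric]) (auto simp: nn_integral_cmult k1)
  qed
  also have "\<dots> = (\<integral>\<^sup>+x. ennreal (f x) * (\<Sum>j\<in>J. ennreal (I j x)) \<partial>M1)"
    using f0 I0 by (subst nn_integral_sum[symmetric])
      (auto simp: sum_distrib_left ennreal_mult' simp del: sum_ennreal intro!: nn_integral_cong)
  also have "\<dots> \<le> (\<integral>\<^sup>+x. ennreal (f x) \<partial>M1)"
  proof (rule nn_integral_mono)
    fix x
    have "(\<Sum>j\<in>J. I j x * 1) \<le> 1"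
    proof (cases "i x \<in> J")
      case True then show ?thesis using one[OF True, of "\<lambda>_. 1"] by simp
    next
      case False then have "(\<Sum>j\<in>J. I j x * 1) = 0" by (intro sum.neutral) (auto simp: I_def)
      then show ?thesis by simp
    qed
    then have "(\<Sum>j\<in>J. ennreal (I j x)) \<le> 1" by (simp add: sum_ennreal I0)
    then show "ennreal (f x) * (\<Sum>j\<in>J. ennreal (I j x)) \<le> ennreal (f x)"
      using mult_left_mono[of _ 1 "ennreal (f x)"] by simp
  qed
  also have "\<dots> = emeasure (density M1 (\<lambda>x. ennreal (f x))) (space M1)"
    by (subst emeasure_density) (auto intro!: nn_integral_cong)
  also have "\<dots> = 1"
    using prob_space.emeasure_space_1[OF N1(1)] sets_eq_imp_space_eq[OF N1(2)] by (simp add: f(1))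
  finally have F1: "(\<integral>\<^sup>+z. ennreal (F z) \<partial>(M1 \<Otimes>\<^sub>M M2)) \<le> 1" .

  have f_pos: "AE z in N. f (fst z) > 0"
    using f(2) unfolding N1_def by (subst (asm) AE_distr_iff) auto
  have k_pos: "AE z in N. i (fst z) = j \<longrightarrow> k j (snd z) > 0" if j: "j \<in> J" for j
  proof (rule AE_I')
    have [measurable]: "{y\<in>space M2. \<not> k j y > 0} \<in> sets M2" by measurable
    have "emeasure (h j) {y\<in>space M2. \<not> k j y > 0} = 0"
      using k(2)[OF j] by (subst (asm) AE_iff_measurable) (auto simp: hs[OF j] hsp[OF j])
    then show "{x\<in>space M1. i x = j} \<times> {y\<in>space M2. \<not> k j y > 0} \<in> null_sets N"
      using hN[OF j, of "{y\<in>space M2. \<not> k j y > 0}"] by (auto simp: null_sets_def)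
  qed (auto simp: sp)
  have k_pos': "AE z in N. \<forall>j\<in>J. i (fst z) = j \<longrightarrow> k j (snd z) > 0"
    by (rule AE_finite_allI[OF J k_pos])
  define a where "a z = ln (f (fst z))" for z :: "'a \<times> 'b"
  define b where "b z = (\<Sum>j\<in>J. I j (fst z) * ln (k j (snd z)))" for z
  have [measurable]: "a \<in> borel_measurable N" "b \<in> borel_measurable N"
    unfolding a_def[abs_def] b_def[abs_def] by measurable
  have Fab: "AE z in N. F z > 0 \<and> ln (F z) = a z + b z"
    using f_pos k_pos' iJ
  proof eventually_elim
    case (elim z)
    then show ?case
      by (auto simp: F_def a_def b_def one ln_mult)
  qed
  have Fpos: "AE z in N. F z > 0" using Fab by eventually_elim auto
  note G = Gibbs_inequality[OF P.prob_space_axioms N s fin F_meas F1 F0 Fpos]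

  have a_nn: "(\<integral>\<^sup>+z. ennreal (g (a z)) \<partial>N) = (\<integral>\<^sup>+x. ennreal (g (entropy_density (exp 1) M1 N1 x)) \<partial>N1)"
    if [measurable]: "g \<in> borel_measurable borel" for g :: "real \<Rightarrow> real"
    unfolding a_def entropy_density_eq N1_def f_def by (subst nn_integral_distr) auto
  have b_nn: "(\<integral>\<^sup>+z. ennreal (g (b z)) \<partial>N)
      = (\<Sum>j\<in>J. ennreal (p j) * (\<integral>\<^sup>+y. ennreal (g (entropy_density (exp 1) M2 (h j) y)) \<partial>h j))"
    if g[measurable]: "g \<in> borel_measurable borel" for g :: "real \<Rightarrow> real"
  proof -
    have "(\<integral>\<^sup>+z. ennreal (g (b z)) \<partial>N)
        = (\<integral>\<^sup>+z. (\<Sum>j\<in>J. ennreal (I j (fst z)) * ennreal (g (ln (k j (snd z))))) \<partial>N)"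
    proof (rule nn_integral_cong_AE, use iJ in eventually_elim)
      case (elim z)
      have "(\<Sum>j\<in>J. ennreal (I j (fst z)) * ennreal (g (ln (k j (snd z)))))
          = (\<Sum>j\<in>J. if j = i (fst z) then ennreal (g (ln (k j (snd z)))) else 0)"
        by (intro sum.cong) (auto simp: I_def)
      then show ?case using J elim by (simp add: b_def one)
    qed
    also have "\<dots> = (\<Sum>j\<in>J. \<integral>\<^sup>+z. ennreal (I j (fst z)) * ennreal (g (ln (k j (snd z)))) \<partial>N)"
      by (rule nn_integral_sum) measurable
    also have "\<dots> = (\<Sum>j\<in>J. ennreal (p j) * (\<integral>\<^sup>+y. ennreal (g (ln (k j y))) \<partial>h j))"
      by (intro sum.cong refl restrict_nn) measurable
    finally show ?thesis by (simp add: entropy_density_eq k_def)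
  qed
  have a_neg: "(\<integral>\<^sup>+z. ennreal (- a z) \<partial>N) < \<infinity>"
    using a_nn[of uminus] entropy_density_neg_part[OF M1 N1 ac1] by (simp add: order_le_less_trans)
  have b_neg: "(\<integral>\<^sup>+z. ennreal (- b z) \<partial>N) < \<infinity>"
  proof -
    have "(\<integral>\<^sup>+y. ennreal (- entropy_density (exp 1) M2 (h j) y) \<partial>h j) < \<infinity>" if "j \<in> J" for j
      using entropy_density_neg_part[OF M2 h[OF that] hs[OF that] ac2[OF that]]
      by (simp add: order_le_less_trans)
    then show ?thesis
      using b_nn[of uminus] J by (simp add: ennreal_mult_less_top)
  qed
  have ab_pos: "(\<integral>\<^sup>+z. ennreal (a z + b z) \<partial>N) < \<infinity>"
  proof -
    have "(\<integral>\<^sup>+z. ennreal (a z + b z) \<partial>N) = (\<integral>\<^sup>+z. ennreal (ln (F z)) \<partial>N)"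
      by (rule nn_integral_cong_AE, use Fab in eventually_elim) auto
    with G(1) show ?thesis by simp
  qed
  \<comment> \<open>The Gibbs inequality controls the positive part of the sum \<open>a + b\<close> only. As both negative parts are
      finite, \<open>u\<^sup>+ \<le> (u + v)\<^sup>+ + v\<^sup>-\<close> separates the two summands.\<close>
  have part: "(\<integral>\<^sup>+z. ennreal (u z) \<partial>N) < \<infinity>"
    if [measurable]: "u \<in> borel_measurable N" "v \<in> borel_measurable N"
      and uv: "(\<integral>\<^sup>+z. ennreal (u z + v z) \<partial>N) < \<infinity>" and v: "(\<integral>\<^sup>+z. ennreal (- v z) \<partial>N) < \<infinity>"
    for u v :: "'a \<times> 'b \<Rightarrow> real"
  proof -
    have "(\<integral>\<^sup>+z. ennreal (u z) \<partial>N) \<le> (\<integral>\<^sup>+z. ennreal (u z + v z) + ennreal (- v z) \<partial>N)"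
    proof (rule nn_integral_mono)
      fix z
      have "ennreal (u z) \<le> ennreal (max 0 (u z + v z) + max 0 (- v z))"
        by (rule ennreal_leI) linarith
      also have "\<dots> = ennreal (u z + v z) + ennreal (- v z)"
        by (subst ennreal_plus) (auto simp: max_def ennreal_neg)
      finally show "ennreal (u z) \<le> ennreal (u z + v z) + ennreal (- v z)" .
    qed
    also have "\<dots> < \<infinity>" using uv v by (subst nn_integral_add) auto
    finally show ?thesis .
  qed
  have a_fin: "(\<integral>\<^sup>+z. ennreal (a z) \<partial>N) < \<infinity>" by (rule part[OF _ _ ab_pos b_neg]) measurable
  have b_fin: "(\<integral>\<^sup>+z. ennreal (b z) \<partial>N) < \<infinity>"
    by (rule part[of b a]) (use ab_pos a_neg in \<open>auto simp: add.commute\<close>)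
  have ai: "integrable N a" and bi: "integrable N b"
    unfolding real_integrable_def using a_fin b_fin a_neg b_neg by auto
  show fin1: "rel_entropy (distr N M1 fst) M1 < \<infinity>"
    using a_fin a_nn[of "\<lambda>x. x"] ac1 rel_entropy_finite_iff(1)[OF M1 N1] by (simp add: N1_def)
  show fin2: "rel_entropy (h j) M2 < \<infinity>" if j: "j \<in> J" for j
  proof -
    have "(\<Sum>j\<in>J. ennreal (p j) * (\<integral>\<^sup>+y. ennreal (entropy_density (exp 1) M2 (h j) y) \<partial>h j)) < \<infinity>"
      using b_fin b_nn[of "\<lambda>x. x"] by simp
    then have "ennreal (p j) * (\<integral>\<^sup>+y. ennreal (entropy_density (exp 1) M2 (h j) y) \<partial>h j) < \<infinity>"
      using J j by simp
    then show ?thesis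
      using p[OF j] ac2[OF j] rel_entropy_finite_iff(1)[OF M2 h[OF j] hs[OF j]]
      by (auto simp: ennreal_mult_less_top ennreal_eq_0_iff)
  qed
  have a_int: "(\<integral>z. a z \<partial>N) = (\<integral>x. entropy_density (exp 1) M1 N1 x \<partial>N1)"
    unfolding a_def entropy_density_eq N1_def f_def by (subst integral_distr) auto
  have restrict_int: "(\<integral>z. I j (fst z) * ln (k j (snd z)) \<partial>N) = p j * (\<integral>y. entropy_density (exp 1) M2 (h j) y \<partial>h j)"
    "integrable N (\<lambda>z. I j (fst z) * ln (k j (snd z)))"
    if j: "j \<in> J" for j
  proof -
    have [measurable]: "k j \<in> borel_measurable (h j)"
      by (simp add: measurable_cong_sets[OF hs[OF j] refl])
    have hi: "integrable (h j) (\<lambda>y. ln (k j y))"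
      using rel_entropy_finite_iff(2)[OF M2 h[OF j] hs[OF j] fin2[OF j]]
      by (simp add: k_def entropy_density_eq[abs_def])
    have "integrable (density (h j) (\<lambda>_. ennreal (p j))) (\<lambda>y. ln (k j y))"
      using hi p[OF j] by (subst integrable_density) auto
    then have "integrable (distr (density N (\<lambda>z. ennreal (I j (fst z)))) M2 snd) (\<lambda>y. ln (k j y))"
      by (simp add: restrict[OF j])
    then show "integrable N (\<lambda>z. I j (fst z) * ln (k j (snd z)))"
      by (subst (asm) integrable_distr_eq; simp add: integrable_density I0)
    have "(\<integral>z. I j (fst z) * ln (k j (snd z)) \<partial>N)
        = (\<integral>y. ln (k j y) \<partial>distr (density N (\<lambda>z. ennreal (I j (fst z)))) M2 snd)"
      by (subst integral_distr; simp add: integral_density I0)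
    also have "\<dots> = p j * (\<integral>y. ln (k j y) \<partial>h j)"
      unfolding restrict[OF j] using p[OF j] by (subst integral_density) auto
    finally show "(\<integral>z. I j (fst z) * ln (k j (snd z)) \<partial>N)
        = p j * (\<integral>y. entropy_density (exp 1) M2 (h j) y \<partial>h j)"
      by (simp add: k_def entropy_density_eq)
  qed
  have b_int: "(\<integral>z. b z \<partial>N) = (\<Sum>j\<in>J. p j * (\<integral>y. entropy_density (exp 1) M2 (h j) y \<partial>h j))"
    unfolding b_def by (subst Bochner_Integration.integral_sum) (auto simp: restrict_int)
  have ab: "integrable N (\<lambda>z. a z + b z)" using ai bi by simp
  have lnF: "AE z in N. ln (F z) = a z + b z" using Fab by eventually_elim auto
  have "integrable N (\<lambda>z. ln (F z)) \<longleftrightarrow> integrable N (\<lambda>z. a z + b z)"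
    by (rule integrable_cong_AE[OF _ _ lnF]) measurable
  moreover have "(\<integral>z. ln (F z) \<partial>N) = (\<integral>z. a z + b z \<partial>N)"
    by (rule integral_cong_AE[OF _ _ lnF]) measurable
  ultimately
  have "ereal ((\<integral>z. a z \<partial>N) + (\<integral>z. b z \<partial>N)) \<le> rel_entropy N (M1 \<Otimes>\<^sub>M M2)"
    using ab ai bi G(2) by simp
  moreover have "rel_entropy N1 M1 = ereal (\<integral>z. a z \<partial>N)"
    using rel_entropy_finite_iff(3)[OF M1 N1] fin1 a_int by (simp add: N1_def)
  moreover have "(\<Sum>j\<in>J. ereal (p j) * rel_entropy (h j) M2) = ereal (\<integral>z. b z \<partial>N)"
  proof -
    have "(\<Sum>j\<in>J. ereal (p j) * rel_entropy (h j) M2)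
        = (\<Sum>j\<in>J. ereal (p j * (\<integral>y. entropy_density (exp 1) M2 (h j) y \<partial>h j)))"
      by (intro sum.cong refl) (simp add: rel_entropy_finite_iff(3)[OF M2 h hs fin2])
    then show ?thesis by (simp add: b_int)
  qed
  ultimately show "rel_entropy (distr N M1 fst) M1 + (\<Sum>j\<in>J. ereal (p j) * rel_entropy (h j) M2)
      \<le> rel_entropy N (M1 \<Otimes>\<^sub>M M2)"
    by (simp add: N1_def)
qed

section \<open>Convex cost functions and their inf-convolution\<close>

lemma class_C_props:
  assumes "\<alpha> \<in> class_C"
  shows "\<And>s t. 0 \<le> s \<Longrightarrow> s \<le> t \<Longrightarrow> \<alpha> s \<le> \<alpha> t" and "\<alpha> 0 = 0"
    and "\<And>s t u. 0 \<le> s \<Longrightarrow> 0 \<le> t \<Longrightarrow> u \<in> {0..1} \<Longrightarrow>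
      \<alpha> ((1 - u) * s + u * t) \<le> ennreal (1 - u) * \<alpha> s + ennreal u * \<alpha> t"
    and "\<And>t. 0 < t \<Longrightarrow> (\<alpha> \<longlongrightarrow> \<alpha> t) (at_left t)"
  using assms unfolding class_C_def mono_on_def by (auto simp: continuous_within)

text \<open>
  Where all values are finite this is Jensen's inequality for a real convex function on the convex set
  \<open>{t. 0 \<le> t \<and> \<alpha> t < \<top>}\<close>; an infinite value makes the right-hand side infinite because all weights are
  positive.
\<close>

lemma class_C_Jensen:
  assumes \<alpha>: "\<alpha> \<in> class_C" and J: "finite J" and p: "\<And>j. j \<in> J \<Longrightarrow> p j > 0"
    and p1: "(\<Sum>j\<in>J. p j) = 1" and x: "\<And>j. j \<in> J \<Longrightarrow> x j \<ge> 0"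
  shows "\<alpha> (\<Sum>j\<in>J. p j * x j) \<le> (\<Sum>j\<in>J. ennreal (p j) * \<alpha> (x j))"
proof (cases "\<forall>j\<in>J. \<alpha> (x j) < \<top>")
  case False
  then obtain j where j: "j \<in> J" "\<alpha> (x j) = \<top>" using top.not_eq_extremum by blast
  then have "(\<Sum>j\<in>J. ennreal (p j) * \<alpha> (x j)) = \<top>"
    using J p[OF j(1)] by (auto simp: ennreal_mult_eq_top_iff)
  then show ?thesis by simp
next
  case True
  define D where "D = {t. t \<ge> 0 \<and> \<alpha> t < \<top>}"
  have fin: "(1 - u) * s + u * t \<in> D" if "s \<in> D" "t \<in> D" "u \<in> {0..1}" for s t u
    using that class_C_props(3)[OF \<alpha>, of s t u]
    by (auto simp: D_def ennreal_mult_less_top ennreal_add_less_top elim!: order_le_less_trans)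
  have "convex_on D (\<lambda>t. enn2real (\<alpha> t))"
  proof (rule convex_onI)
    show "convex D"
      unfolding convex_alt using fin by auto
    fix u s t :: real assume u: "0 < u" "u < 1" and st: "s \<in> D" "t \<in> D"
    have "\<alpha> ((1 - u) * s + u * t) \<le> ennreal (1 - u) * \<alpha> s + ennreal u * \<alpha> t"
      using class_C_props(3)[OF \<alpha>, of s t u] st u by (auto simp: D_def)
    moreover obtain a b where ab: "\<alpha> s = ennreal a" "a \<ge> 0" "\<alpha> t = ennreal b" "b \<ge> 0"
      using st by (cases "\<alpha> s"; cases "\<alpha> t") (auto simp: D_def)
    ultimately have "\<alpha> ((1 - u) * s + u * t) \<le> ennreal ((1 - u) * a + u * b)"
      using u by (simp add: ennreal_mult ennreal_plus)
    then have "enn2real (\<alpha> ((1 - u) * s + u * t)) \<le> (1 - u) * a + u * b"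
      using ab u by (intro enn2real_leI) auto
    then show "enn2real (\<alpha> ((1 - u) *\<^sub>R s + u *\<^sub>R t)) \<le> (1 - u) * enn2real (\<alpha> s) + u * enn2real (\<alpha> t)"
      using ab by simp
  qed
  moreover have xD: "x j \<in> D" if "j \<in> J" for j using True x that by (auto simp: D_def)
  moreover have "J \<noteq> {}" using p1 by auto
  ultimately have conv: "enn2real (\<alpha> (\<Sum>j\<in>J. p j *\<^sub>R x j)) \<le> (\<Sum>j\<in>J. p j * enn2real (\<alpha> (x j)))"
    and "(\<Sum>j\<in>J. p j *\<^sub>R x j) \<in> D"
    using convex_on_sum[OF J, of D "\<lambda>t. enn2real (\<alpha> t)" p x] convex_sum[OF J, of D p x] p p1
    by (auto simp: convex_on_def less_imp_le)
  then have "\<alpha> (\<Sum>j\<in>J. p j * x j) = ennreal (enn2real (\<alpha> (\<Sum>j\<in>J. p j * x j)))"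
    by (simp add: D_def)
  also have "\<dots> \<le> ennreal (\<Sum>j\<in>J. p j * enn2real (\<alpha> (x j)))"
    using conv by (intro ennreal_leI) simp
  also have "\<dots> = (\<Sum>j\<in>J. ennreal (p j) * \<alpha> (x j))"
    using p True by (subst sum_ennreal[symmetric]) (auto simp: ennreal_mult less_imp_le intro!: sum.cong)
  finally show ?thesis .
qed

text \<open>
  By convexity and \<open>\<alpha> 0 = 0\<close>, \<open>\<alpha> (n * t) \<ge> n * \<alpha> t\<close>.
\<close>

lemma class_C_unbounded:
  assumes \<alpha>: "\<alpha> \<in> class_C" and t: "t \<ge> 0" "\<alpha> t \<noteq> 0"
  obtains T where "T \<ge> 0" "\<alpha> T > ennreal C"
proof -
  obtain a where a: "0 < a" "ennreal a \<le> \<alpha> t"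
  proof (cases "\<alpha> t")
    case (real r)
    then show thesis using t(2) by (intro that[of r]) auto
  qed (use that[of 1] in auto)
  obtain n :: nat where n: "n > max 1 (C / a)" using reals_Archimedean2 by blast
  have n1: "real n > 0" using n by linarith
  have "\<alpha> ((1 - 1 / n) * 0 + (1 / n) * (n * t)) \<le> ennreal (1 - 1 / n) * \<alpha> 0 + ennreal (1 / n) * \<alpha> (n * t)"
    using n n1 t by (intro class_C_props(3)[OF \<alpha>]) auto
  then have "ennreal a \<le> ennreal (1 / n) * \<alpha> (n * t)"
    using n1 a by (simp add: class_C_props(2)[OF \<alpha>])
  then have "ennreal n * ennreal a \<le> ennreal n * (ennreal (1 / n) * \<alpha> (n * t))"
    by (rule mult_left_mono) simp
  also have "\<dots> = \<alpha> (n * t)"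
    using n1 by (simp add: mult.assoc[symmetric] ennreal_mult[symmetric])
  finally have "ennreal (n * a) \<le> \<alpha> (n * t)" using a by (simp add: ennreal_mult)
  moreover have "C < n * a" using n a by (simp add: field_simps)
  then have "ennreal C < ennreal (n * a)" using a n1 by (simp add: ennreal_lessI)
  ultimately show thesis using t n1 by (intro that[of "n * t"]) auto
qed

lemma extend_infty_eq_top:
  assumes \<alpha>: "\<alpha> \<in> class_C" and t: "t \<ge> 0" "\<alpha> t \<noteq> 0"
  shows "extend_infty \<alpha> \<infinity> = \<infinity>"
proof -
  have "(\<alpha> \<longlongrightarrow> \<top>) at_top"
  proof (rule order_tendstoI)
    fix c :: ennreal assume "c < \<top>"
    then obtain C where C: "c = ennreal C" by (cases c) auto
    obtain T where T: "T \<ge> 0" "\<alpha> T > ennreal C" using class_C_unbounded[OF \<alpha> t] .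
    show "\<forall>\<^sub>F s in at_top. c < \<alpha> s"
      using eventually_ge_at_top[of T]
      by eventually_elim (use class_C_props(1)[OF \<alpha> T(1)] T(2) C in \<open>auto intro: order_less_le_trans\<close>)
  qed auto
  then show ?thesis by (simp add: extend_infty_def tendsto_Lim)
qed

text \<open>
  Monotonicity lets \<open>t\<close> fall short of \<open>t\<^sub>1 + t\<^sub>2\<close>: the decomposition of \<open>t\<close> into \<open>min t t\<^sub>1\<close> and the remainder is
  dominated in both components.
\<close>

lemma inf_convolution_le:
  assumes "\<alpha>\<^sub>1 \<in> class_C" "\<alpha>\<^sub>2 \<in> class_C" "0 \<le> t" "0 \<le> t\<^sub>1" "0 \<le> t\<^sub>2" "t \<le> t\<^sub>1 + t\<^sub>2"
  shows "(\<alpha>\<^sub>1 \<box> \<alpha>\<^sub>2) t \<le> \<alpha>\<^sub>1 t\<^sub>1 + \<alpha>\<^sub>2 t\<^sub>2"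
proof -
  have "(\<alpha>\<^sub>1 \<box> \<alpha>\<^sub>2) t \<le> \<alpha>\<^sub>1 (min t t\<^sub>1) + \<alpha>\<^sub>2 (t - min t t\<^sub>1)"
    unfolding inf_convolution_def using assms(3-)
    by (intro Inf_lower CollectI exI[of _ "min t t\<^sub>1"] exI[of _ "t - min t t\<^sub>1"]) auto
  also have "\<dots> \<le> \<alpha>\<^sub>1 t\<^sub>1 + \<alpha>\<^sub>2 t\<^sub>2"
    using assms by (intro add_mono class_C_props(1)) auto
  finally show ?thesis .
qed

lemma extend_infty_eq_0:
  assumes "\<And>t. t \<ge> 0 \<Longrightarrow> \<alpha> t = 0"
  shows "extend_infty \<alpha> t = 0"
proof (cases "t = \<infinity>")
  case True
  have "(\<alpha> \<longlongrightarrow> 0) at_top"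
    by (intro tendsto_eventually eventually_mono[OF eventually_ge_at_top[of 0]] assms)
  then show ?thesis using True by (simp add: extend_infty_def tendsto_Lim)
qed (simp add: extend_infty_def assms)

text \<open>
  Sublevel sets are bounded because \<open>\<alpha>\<close> grows without bound, and left continuity makes their supremum
  a maximum.
\<close>

lemma class_C_sublevel_Sup:
  assumes \<alpha>: "\<alpha> \<in> class_C" and t: "t \<ge> 0" "\<alpha> t \<noteq> 0"
  obtains S where "S \<ge> 0" "\<alpha> S \<le> ennreal C" "\<And>s. s \<ge> 0 \<Longrightarrow> \<alpha> s \<le> ennreal C \<Longrightarrow> s \<le> S"
proof -
  define X where "X = {s. s \<ge> 0 \<and> \<alpha> s \<le> ennreal C}"
  obtain T where T: "T \<ge> 0" "\<alpha> T > ennreal C" using class_C_unbounded[OF \<alpha> t] .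
  have XT: "s \<le> T" if "s \<in> X" for s
    using that T class_C_props(1)[OF \<alpha>, of T s] by (force simp: X_def not_le[symmetric])
  then have bdd: "bdd_above X" by (rule bdd_aboveI)
  have "0 \<in> X" by (simp add: X_def class_C_props(2)[OF \<alpha>])
  define S where "S = Sup X"
  have upper: "s \<le> S" if "s \<in> X" for s unfolding S_def using bdd that by (rule cSup_upper[rotated])
  have "S \<ge> 0" using upper[OF \<open>0 \<in> X\<close>] .
  moreover have "\<alpha> S \<le> ennreal C"
  proof (cases "S = 0")
    case True then show ?thesis by (simp add: class_C_props(2)[OF \<alpha>])
  next
    case False
    with \<open>S \<ge> 0\<close> have "S > 0" by simp
    have below: "\<alpha> s \<le> ennreal C" if s: "0 < s" "s < S" for s
    proof -
      obtain x where "x \<in> X" "s < x"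
        using s(2) \<open>0 \<in> X\<close> unfolding S_def by (auto dest: less_cSupD[rotated])
      then show ?thesis using class_C_props(1)[OF \<alpha>, of s x] s by (auto simp: X_def)
    qed
    show ?thesis
    proof (rule tendsto_upperbound[OF class_C_props(4)[OF \<alpha> \<open>S > 0\<close>]])
      show "\<forall>\<^sub>F s in at_left S. \<alpha> s \<le> ennreal C"
        using eventually_at_left_real[OF \<open>S > 0\<close>] by eventually_elim (auto intro: below)
    qed simp
  qed
  ultimately show thesis using that upper by (auto simp: X_def)
qed

section \<open>Glueing couplings along a partition\<close>

lemma coupling_props:
  assumes "\<pi> \<in> couplings \<mu> \<nu>"
  shows "prob_space \<pi>" "sets \<pi> = sets borel" "distr \<pi> borel fst = \<mu>" "distr \<pi> borel snd = \<nu>"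
  using assms by (auto simp: couplings_def borel_probs_def)

text \<open>
  Sample \<open>(x\<^sub>1, y\<^sub>1)\<close> from \<open>\<pi>\<close>, then \<open>(x\<^sub>2, y\<^sub>2)\<close> from the coupling \<open>\<kappa> j\<close> chosen by the cell \<open>j = i y\<^sub>1\<close> of the endpoint,
  and pair up the starting points and the endpoints. Since the second step looks only at a natural
  number, measurability of the kernel is automatic.
\<close>

definition glue ::
  "('a::second_countable_topology \<times> 'a) measure \<Rightarrow> ('a \<Rightarrow> nat) \<Rightarrow>
    (nat \<Rightarrow> ('b::second_countable_topology \<times> 'b) measure) \<Rightarrow> (('a \<times> 'b) \<times> ('a \<times> 'b)) measure" where
  "glue \<pi> i \<kappa> = \<pi> \<bind> (\<lambda>p. distr (\<kappa> (i (snd p))) borel (\<lambda>q. ((fst p, fst q), (snd p, snd q))))"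

context
  fixes \<pi> :: "('a::second_countable_topology \<times> 'a) measure" and i :: "'a \<Rightarrow> nat"
    and \<kappa> :: "nat \<Rightarrow> ('b::second_countable_topology \<times> 'b) measure"
    and \<mu>\<^sub>1 \<nu>\<^sub>1 :: "'a measure" and \<mu>\<^sub>2 :: "'b measure" and h :: "nat \<Rightarrow> 'b measure"
  assumes \<pi>: "\<pi> \<in> couplings \<mu>\<^sub>1 \<nu>\<^sub>1" and \<kappa>: "\<And>j. \<kappa> j \<in> couplings \<mu>\<^sub>2 (h j)"
    and i[measurable]: "i \<in> borel \<rightarrow>\<^sub>M count_space UNIV"
begin

lemma glue_kernel_measurable:
  "(\<lambda>p. distr (\<kappa> (i (snd p))) borel (\<lambda>q. ((fst p, fst q), (snd p, snd q)))) \<in> \<pi> \<rightarrow>\<^sub>M prob_algebra borel"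
proof -
  note [measurable_cong] = coupling_props(2)[OF \<pi>]
  have [measurable]: "\<kappa> \<in> count_space UNIV \<rightarrow>\<^sub>M prob_algebra borel"
    using coupling_props(1,2)[OF \<kappa>] by (simp add: space_prob_algebra)
  have "(\<lambda>p. \<kappa> (i (snd p))) \<in> \<pi> \<rightarrow>\<^sub>M prob_algebra borel" by measurable
  moreover have "(\<lambda>(p, q :: 'b \<times> 'b). ((fst p, fst q), (snd p, snd q))) \<in> \<pi> \<Otimes>\<^sub>M borel \<rightarrow>\<^sub>M borel"
    unfolding case_prod_beta' by measurable
  ultimately show ?thesis by (rule measurable_distr_prob_space2)
qed

lemma glue_in_borel_probs: "glue \<pi> i \<kappa> \<in> borel_probs"
proof -
  have \<pi>': "\<pi> \<in> space (prob_algebra \<pi>)" using coupling_props(1)[OF \<pi>] by (simp add: space_prob_algebra)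
  show ?thesis
    unfolding borel_probs_def glue_def
    using prob_space_bind'[OF \<pi>' glue_kernel_measurable] sets_bind'[OF \<pi>' glue_kernel_measurable] by simp
qed

lemma nn_integral_glue:
  assumes f[measurable]: "f \<in> borel_measurable borel"
  shows "(\<integral>\<^sup>+z. f z \<partial>glue \<pi> i \<kappa>)
    = (\<integral>\<^sup>+p. \<integral>\<^sup>+q. f ((fst p, fst q), (snd p, snd q)) \<partial>\<kappa> (i (snd p)) \<partial>\<pi>)"
proof -
  have "(\<integral>\<^sup>+z. f z \<partial>glue \<pi> i \<kappa>) = (\<integral>\<^sup>+p. \<integral>\<^sup>+z. f z
      \<partial>distr (\<kappa> (i (snd p))) borel (\<lambda>q. ((fst p, fst q), (snd p, snd q))) \<partial>\<pi>)"
    unfolding glue_def by (rule nn_integral_bind[OF f measurable_prob_algebraD[OF glue_kernel_measurable]])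
  also have "\<dots> = (\<integral>\<^sup>+p. \<integral>\<^sup>+q. f ((fst p, fst q), (snd p, snd q)) \<partial>\<kappa> (i (snd p)) \<partial>\<pi>)"
  proof (intro nn_integral_cong nn_integral_distr)
    fix p :: "'a \<times> 'a"
    note [measurable_cong] = coupling_props(2)[OF \<kappa>]
    show "(\<lambda>q. ((fst p, fst q), (snd p, snd q))) \<in> \<kappa> (i (snd p)) \<rightarrow>\<^sub>M borel"
      by measurable
  qed (use f in simp)
  finally show ?thesis .
qed

lemma nn_integral_coupling_marginals:
  assumes [measurable]: "g \<in> borel_measurable borel"
  shows "(\<integral>\<^sup>+p. g (fst p) \<partial>\<pi>) = (\<integral>\<^sup>+x. g x \<partial>\<mu>\<^sub>1)" "(\<integral>\<^sup>+p. g (snd p) \<partial>\<pi>) = (\<integral>\<^sup>+x. g x \<partial>\<nu>\<^sub>1)"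
proof -
  note [measurable_cong] = coupling_props(2)[OF \<pi>]
  show "(\<integral>\<^sup>+p. g (fst p) \<partial>\<pi>) = (\<integral>\<^sup>+x. g x \<partial>\<mu>\<^sub>1)"
    by (subst coupling_props(3)[OF \<pi>, symmetric], subst nn_integral_distr) auto
  show "(\<integral>\<^sup>+p. g (snd p) \<partial>\<pi>) = (\<integral>\<^sup>+x. g x \<partial>\<nu>\<^sub>1)"
    by (subst coupling_props(4)[OF \<pi>, symmetric], subst nn_integral_distr) auto
qed

lemma emeasure_coupling_marginals:
  assumes [measurable]: "B \<in> sets borel"
  shows "(\<integral>\<^sup>+q. indicator B (fst q) \<partial>\<kappa> j) = emeasure \<mu>\<^sub>2 B" "(\<integral>\<^sup>+q. indicator B (snd q) \<partial>\<kappa> j) = emeasure (h j) B"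
proof -
  note [measurable_cong] = coupling_props(2)[OF \<kappa>[of j]]
  have s: "sets \<mu>\<^sub>2 = sets borel" "sets (h j) = sets borel"
    using coupling_props(3,4)[OF \<kappa>[of j]] by (metis sets_distr)+
  have "(\<integral>\<^sup>+q. indicator B (fst q) \<partial>\<kappa> j) = (\<integral>\<^sup>+y. indicator B y \<partial>\<mu>\<^sub>2)"
    by (subst coupling_props(3)[OF \<kappa>[of j], symmetric], subst nn_integral_distr) auto
  then show "(\<integral>\<^sup>+q. indicator B (fst q) \<partial>\<kappa> j) = emeasure \<mu>\<^sub>2 B" by (simp add: s)
  have "(\<integral>\<^sup>+q. indicator B (snd q) \<partial>\<kappa> j) = (\<integral>\<^sup>+y. indicator B y \<partial>h j)"
    by (subst coupling_props(4)[OF \<kappa>[of j], symmetric], subst nn_integral_distr) auto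
  then show "(\<integral>\<^sup>+q. indicator B (snd q) \<partial>\<kappa> j) = emeasure (h j) B" by (simp add: s)
qed

text \<open>
  All the couplings \<open>\<kappa> j\<close> start from the same measure \<open>\<mu>\<^sub>2\<close>, so the second starting point is independent of the
  first step.
\<close>

lemma glue_first_marginal: "distr (glue \<pi> i \<kappa>) borel fst = \<mu>\<^sub>1 \<Otimes>\<^sub>M \<mu>\<^sub>2"
proof -
  note [measurable_cong] = coupling_props(2)[OF \<pi>]
  have s[measurable_cong]: "sets (glue \<pi> i \<kappa>) = sets borel" using glue_in_borel_probs by (simp add: borel_probs_def)
  have s1: "sets \<mu>\<^sub>1 = sets borel" and s2: "sets \<mu>\<^sub>2 = sets borel"
    using coupling_props(3)[OF \<pi>] coupling_props(3)[OF \<kappa>[of 0]] by (metis sets_distr)+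
  have P: "prob_space \<mu>\<^sub>1" "prob_space \<mu>\<^sub>2"
    using prob_space.prob_space_distr[OF coupling_props(1)[OF \<pi>], of fst borel]
      prob_space.prob_space_distr[OF coupling_props(1)[OF \<kappa>[of 0]], of fst borel]
    by (simp_all add: coupling_props(3)[OF \<pi>] coupling_props(3)[OF \<kappa>] measurable_cong_sets[OF coupling_props(2)[OF \<pi>] refl]
          measurable_cong_sets[OF coupling_props(2)[OF \<kappa>] refl])
  show ?thesis
  proof (rule pair_measure_eqI[symmetric])
    show "sigma_finite_measure \<mu>\<^sub>1" "sigma_finite_measure \<mu>\<^sub>2"
      using P by (simp_all add: prob_space_imp_sigma_finite)
    show "sets (\<mu>\<^sub>1 \<Otimes>\<^sub>M \<mu>\<^sub>2) = sets (distr (glue \<pi> i \<kappa>) borel fst)"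
      by (simp only: sets_pair_measure_cong[OF s1 s2] borel_prod sets_distr)
    fix A B assume "A \<in> sets \<mu>\<^sub>1" "B \<in> sets \<mu>\<^sub>2"
    then have A[measurable]: "A \<in> sets borel" and B[measurable]: "B \<in> sets borel" using s1 s2 by auto
    have AB[measurable]: "A \<times> B \<in> sets borel" by (simp add: borel_prod[symmetric])
    have "emeasure (distr (glue \<pi> i \<kappa>) borel fst) (A \<times> B) = (\<integral>\<^sup>+z. indicator (A \<times> B) z \<partial>distr (glue \<pi> i \<kappa>) borel fst)"
      by simp
    also have "\<dots> = (\<integral>\<^sup>+z. indicator (A \<times> B) (fst z) \<partial>glue \<pi> i \<kappa>)"
      by (rule nn_integral_distr) measurable
    also have "\<dots> = (\<integral>\<^sup>+p. \<integral>\<^sup>+q. indicator A (fst p) * indicator B (fst q) \<partial>\<kappa> (i (snd p)) \<partial>\<pi>)"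
      by (subst nn_integral_glue) (auto simp: indicator_def intro!: nn_integral_cong)
    also have "\<dots> = (\<integral>\<^sup>+p. indicator A (fst p) * emeasure \<mu>\<^sub>2 B \<partial>\<pi>)"
    proof (rule nn_integral_cong)
      fix p
      note [measurable_cong] = coupling_props(2)[OF \<kappa>]
      show "(\<integral>\<^sup>+q. indicator A (fst p) * indicator B (fst q) \<partial>\<kappa> (i (snd p))) = indicator A (fst p) * emeasure \<mu>\<^sub>2 B"
        by (subst nn_integral_cmult) (auto simp: emeasure_coupling_marginals)
    qed
    also have "\<dots> = (\<integral>\<^sup>+p. indicator A (fst p) \<partial>\<pi>) * emeasure \<mu>\<^sub>2 B"
      by (rule nn_integral_multc) measurable
    also have "(\<integral>\<^sup>+p. indicator A (fst p) \<partial>\<pi>) = (\<integral>\<^sup>+x. indicator A x \<partial>\<mu>\<^sub>1)"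
      by (rule nn_integral_coupling_marginals) measurable
    also have "\<dots> = emeasure \<mu>\<^sub>1 A" by (simp add: s1)
    finally show "emeasure \<mu>\<^sub>1 A * emeasure \<mu>\<^sub>2 B = emeasure (distr (glue \<pi> i \<kappa>) borel fst) (A \<times> B)" by simp
  qed
qed

lemma glue_second_marginal:
  assumes A[measurable]: "A \<in> sets borel" and B[measurable]: "B \<in> sets borel"
  shows "emeasure (glue \<pi> i \<kappa>) {z. fst (snd z) \<in> A \<and> snd (snd z) \<in> B}
    = (\<integral>\<^sup>+y. indicator A y * emeasure (h (i y)) B \<partial>\<nu>\<^sub>1)"
proof -
  note [measurable_cong] = coupling_props(2)[OF \<pi>]
  have s[measurable_cong]: "sets (glue \<pi> i \<kappa>) = sets borel" using glue_in_borel_probs by (simp add: borel_probs_def)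
  have AB[measurable]: "{z :: ('a \<times> 'b) \<times> ('a \<times> 'b). fst (snd z) \<in> A \<and> snd (snd z) \<in> B} \<in> sets borel"
    by measurable
  have "emeasure (glue \<pi> i \<kappa>) {z. fst (snd z) \<in> A \<and> snd (snd z) \<in> B}
      = (\<integral>\<^sup>+z. indicator {z. fst (snd z) \<in> A \<and> snd (snd z) \<in> B} z \<partial>glue \<pi> i \<kappa>)"
    by (simp add: s)
  also have "\<dots> = (\<integral>\<^sup>+p. \<integral>\<^sup>+q. indicator A (snd p) * indicator B (snd q) \<partial>\<kappa> (i (snd p)) \<partial>\<pi>)"
    by (subst nn_integral_glue) (auto simp: indicator_def intro!: nn_integral_cong)
  also have "\<dots> = (\<integral>\<^sup>+p. indicator A (snd p) * emeasure (h (i (snd p))) B \<partial>\<pi>)"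
  proof (rule nn_integral_cong)
    fix p
    note [measurable_cong] = coupling_props(2)[OF \<kappa>]
    show "(\<integral>\<^sup>+q. indicator A (snd p) * indicator B (snd q) \<partial>\<kappa> (i (snd p))) = indicator A (snd p) * emeasure (h (i (snd p))) B"
      by (subst nn_integral_cmult) (auto simp: emeasure_coupling_marginals)
  qed
  also have "\<dots> = (\<integral>\<^sup>+y. indicator A y * emeasure (h (i y)) B \<partial>\<nu>\<^sub>1)"
  proof (rule nn_integral_coupling_marginals)
    have [measurable]: "(\<lambda>y. emeasure (h (i y)) B) \<in> borel_measurable borel"
      by (rule measurable_compose[OF i]) simp
    show "(\<lambda>y. indicator A y * emeasure (h (i y)) B) \<in> borel_measurable borel" by measurable
  qed
  finally show ?thesis .
qed

lemma glue_cost: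
  assumes c1[measurable]: "(\<lambda>(x, y). c\<^sub>1 x y) \<in> borel_measurable borel" and "\<And>x y. c\<^sub>1 x y \<ge> (0::real)"
    and c2[measurable]: "(\<lambda>(x, y). c\<^sub>2 x y) \<in> borel_measurable borel" and "\<And>x y. c\<^sub>2 x y \<ge> (0::real)"
  shows "(\<integral>\<^sup>+(x, y). ennreal ((c\<^sub>1 \<oplus>\<^sub>c c\<^sub>2) x y) \<partial>glue \<pi> i \<kappa>)
    = (\<integral>\<^sup>+(x, y). ennreal (c\<^sub>1 x y) \<partial>\<pi>) + (\<integral>\<^sup>+y. (\<integral>\<^sup>+(x, y). ennreal (c\<^sub>2 x y) \<partial>\<kappa> (i y)) \<partial>\<nu>\<^sub>1)"
proof -
  note [measurable_cong] = coupling_props(2)[OF \<pi>] coupling_props(2)[OF \<kappa>]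
  define K where "K j = (\<integral>\<^sup>+q. ennreal (c\<^sub>2 (fst q) (snd q)) \<partial>\<kappa> j)" for j
  have [measurable]: "(\<lambda>y. K (i y)) \<in> borel_measurable borel"
    by (rule measurable_compose[OF i]) simp
  have m1[measurable]: "(\<lambda>z. c\<^sub>1 (f z) (g z)) \<in> borel_measurable M"
    if [measurable]: "f \<in> borel_measurable M" "g \<in> borel_measurable M" for f g and M :: "'z measure"
    using measurable_compose[OF borel_measurable_Pair[OF that] c1] by simp
  have m2[measurable]: "(\<lambda>z. c\<^sub>2 (f z) (g z)) \<in> borel_measurable M"
    if [measurable]: "f \<in> borel_measurable M" "g \<in> borel_measurable M" for f g and M :: "'z measure"
    using measurable_compose[OF borel_measurable_Pair[OF that] c2] by simp
  have "(\<integral>\<^sup>+(x, y). ennreal ((c\<^sub>1 \<oplus>\<^sub>c c\<^sub>2) x y) \<partial>glue \<pi> i \<kappa>)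
      = (\<integral>\<^sup>+p. \<integral>\<^sup>+q. ennreal (c\<^sub>1 (fst p) (snd p)) + ennreal (c\<^sub>2 (fst q) (snd q)) \<partial>\<kappa> (i (snd p)) \<partial>\<pi>)"
    unfolding cost_sum_def case_prod_beta'
    by (subst nn_integral_glue) (auto simp: assms ennreal_plus intro!: nn_integral_cong)
  also have "\<dots> = (\<integral>\<^sup>+p. ennreal (c\<^sub>1 (fst p) (snd p)) + K (i (snd p)) \<partial>\<pi>)"
    unfolding K_def
  proof (rule nn_integral_cong)
    fix p :: "'a \<times> 'a"
    interpret K: prob_space "\<kappa> (i (snd p))" by (rule coupling_props(1)[OF \<kappa>])
    show "(\<integral>\<^sup>+q. ennreal (c\<^sub>1 (fst p) (snd p)) + ennreal (c\<^sub>2 (fst q) (snd q)) \<partial>\<kappa> (i (snd p)))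
        = ennreal (c\<^sub>1 (fst p) (snd p)) + (\<integral>\<^sup>+q. ennreal (c\<^sub>2 (fst q) (snd q)) \<partial>\<kappa> (i (snd p)))"
      by (subst nn_integral_add) (auto simp: K.emeasure_space_1)
  qed
  also have "\<dots> = (\<integral>\<^sup>+p. ennreal (c\<^sub>1 (fst p) (snd p)) \<partial>\<pi>) + (\<integral>\<^sup>+p. K (i (snd p)) \<partial>\<pi>)"
    by (rule nn_integral_add) measurable
  also have "(\<integral>\<^sup>+p. K (i (snd p)) \<partial>\<pi>) = (\<integral>\<^sup>+y. K (i y) \<partial>\<nu>\<^sub>1)"
    by (rule nn_integral_coupling_marginals) measurable
  finally show ?thesis by (simp add: case_prod_beta' K_def)
qed

end

section \<open>Couplings adapted to a finite partition\<close>

lemma sets_pair_borel: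
  fixes \<mu>\<^sub>1 :: "'a::second_countable_topology measure" and \<mu>\<^sub>2 :: "'b::second_countable_topology measure"
  assumes "sets \<mu>\<^sub>1 = sets borel" "sets \<mu>\<^sub>2 = sets borel"
  shows "sets (\<mu>\<^sub>1 \<Otimes>\<^sub>M \<mu>\<^sub>2) = sets borel"
  by (simp only: sets_pair_measure_cong[OF assms] borel_prod)

lemma rel_entropy_fst_marginal_le:
  assumes M1: "prob_space M1" and M2: "prob_space M2"
    and N: "prob_space N" and s[measurable_cong]: "sets N = sets (M1 \<Otimes>\<^sub>M M2)"
    and fin: "rel_entropy N (M1 \<Otimes>\<^sub>M M2) < \<infinity>"
  shows "rel_entropy (distr N M1 fst) M1 \<le> rel_entropy N (M1 \<Otimes>\<^sub>M M2)"
proof -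
  interpret N: prob_space N by fact
  have sp: "space N = space M1 \<times> space M2"
    using sets_eq_imp_space_eq[OF s] by (simp add: space_pair_measure)
  have h: "prob_space (distr N M2 snd)" by (rule N.prob_space_distr) measurable
  have "rel_entropy (distr N M1 fst) M1 + (\<Sum>j\<in>{0::nat}. ereal 1 * rel_entropy (distr N M2 snd) M2)
      \<le> rel_entropy N (M1 \<Otimes>\<^sub>M M2)"
  proof (rule entropy_chain(3)[OF M1 M2 N s fin, where i = "\<lambda>_. 0"])
    fix B assume [measurable]: "B \<in> sets M2"
    show "emeasure N ({x \<in> space M1. 0 = (j::nat)} \<times> B) = ennreal 1 * emeasure (distr N M2 snd) B" if "j \<in> {0}" for j
      using that sets.sets_into_space[of B M2]
      by (subst emeasure_distr) (auto simp: sp intro!: arg_cong[where f = "emeasure N"])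
  qed (use h in auto)
  moreover have "0 \<le> rel_entropy (distr N M2 snd) M2"
    by (rule rel_entropy_nonneg[OF M2 h]) simp
  ultimately show ?thesis by (cases "rel_entropy (distr N M2 snd) M2"; cases "rel_entropy (distr N M1 fst) M1"; cases "rel_entropy N (M1 \<Otimes>\<^sub>M M2)") auto
qed

text \<open>
  A coupling that exists for trivial reasons, to be used on cells of mass zero.
\<close>

lemma diagonal_coupling:
  fixes \<mu> :: "'a::second_countable_topology measure"
  assumes "\<mu> \<in> borel_probs"
  shows "distr \<mu> borel (\<lambda>x. (x, x)) \<in> couplings \<mu> \<mu>"
proof -
  have P: "prob_space \<mu>" and s[measurable_cong]: "sets \<mu> = sets borel"
    using assms by (auto simp: borel_probs_def)
  have [measurable]: "(\<lambda>x. (x, x)) \<in> \<mu> \<rightarrow>\<^sub>M borel" by measurable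
  have "distr \<mu> borel (\<lambda>x. x) = \<mu>" using distr_id2[of borel \<mu>] s by simp
  then show ?thesis unfolding couplings_def borel_probs_def
    by (auto simp: distr_distr comp_def intro!: prob_space.prob_space_distr P)
qed

lemma transport_cost_near_optimal:
  assumes "transport_cost c \<mu> \<nu> \<le> ennreal t" "e > 0" "t \<ge> 0"
  obtains \<pi> where "\<pi> \<in> couplings \<mu> \<nu>" "(\<integral>\<^sup>+ (x, y). ennreal (c x y) \<partial>\<pi>) \<le> ennreal (t + e)"
proof -
  have "ennreal t < ennreal (t + e)" using assms by (simp add: ennreal_lessI)
  with assms(1) have "transport_cost c \<mu> \<nu> < ennreal (t + e)" by (rule order_le_less_trans)
  then show thesis
    unfolding transport_cost_def INF_less_iff using that by (auto intro: less_imp_le)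
qed

text \<open>
  For \<open>\<alpha>\<close> not identically zero, \<open>\<alpha> (+\<infinity>) = +\<infinity>\<close>, so a transport-entropy inequality with finite right-hand side
  forces a finite transport cost.
\<close>

lemma transport_cost_finite:
  assumes \<alpha>: "\<alpha> \<in> class_C" and t: "t \<ge> 0" "\<alpha> t \<noteq> 0"
    and le: "enn2ereal (extend_infty \<alpha> (transport_cost c \<mu> \<nu>)) \<le> H" and H: "H < \<infinity>"
  obtains x where "x \<ge> 0" "transport_cost c \<mu> \<nu> = ennreal x" "enn2ereal (\<alpha> x) \<le> H"
proof (cases "transport_cost c \<mu> \<nu>")
  case (real x)
  with le show thesis by (intro that[of x]) (auto simp: extend_infty_def)
next
  case top
  then show thesis using le H extend_infty_eq_top[OF \<alpha> t] by (auto simp: top_ereal_def)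
qed

text \<open>
  Glueing of \<open>\<pi>\<^sub>1\<close> with nearly optimal couplings of \<open>\<mu>\<^sub>2\<close> and the conditional second marginals \<open>h j\<close> of \<open>\<nu>\<close>. The
  number \<open>x\<close> is the average of the transport costs from \<open>\<mu>\<^sub>2\<close> to \<open>h j\<close>. The real number \<open>a\<close> is a
  lower bound for the entropy of the first marginal, in the application \<open>\<alpha>\<^sub>1\<close> of its transport cost; the
  bound on \<open>\<alpha>\<^sub>2 x\<close> says that the chain inequality leaves at most
  \<open>r - a\<close> of the entropy \<open>r\<close> for the second coordinate.
\<close>

lemma cellwise_coupling:
  fixes \<mu>\<^sub>1 :: "'a::second_countable_topology measure" and \<mu>\<^sub>2 :: "'b::second_countable_topology measure"
    and i :: "'a \<Rightarrow> nat"
  assumes \<mu>1: "\<mu>\<^sub>1 \<in> borel_probs" and \<mu>2: "\<mu>\<^sub>2 \<in> borel_probs" and \<nu>: "\<nu> \<in> borel_probs"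
    and c1: "(\<lambda>(x, y). c\<^sub>1 x y) \<in> borel_measurable borel" and c10: "\<And>x y. c\<^sub>1 x y \<ge> (0::real)"
    and c2: "(\<lambda>(x, y). c\<^sub>2 x y) \<in> borel_measurable borel" and c20: "\<And>x y. c\<^sub>2 x y \<ge> (0::real)"
    and \<alpha>2: "\<alpha>\<^sub>2 \<in> class_C" "s \<ge> 0" "\<alpha>\<^sub>2 s \<noteq> 0"
    and T2: "\<forall>\<nu>\<^sub>2\<in>borel_probs.
      enn2ereal (extend_infty \<alpha>\<^sub>2 (transport_cost c\<^sub>2 \<mu>\<^sub>2 \<nu>\<^sub>2)) \<le> rel_entropy \<nu>\<^sub>2 \<mu>\<^sub>2"
    and r: "rel_entropy \<nu> (\<mu>\<^sub>1 \<Otimes>\<^sub>M \<mu>\<^sub>2) = ereal r"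
    and a: "ereal a \<le> rel_entropy (distr \<nu> borel fst) \<mu>\<^sub>1"
    and i[measurable]: "i \<in> borel \<rightarrow>\<^sub>M count_space UNIV" and fin_i: "finite (range i)"
    and \<pi>1: "\<pi>\<^sub>1 \<in> couplings \<mu>\<^sub>1 (distr \<nu> borel fst)" and e: "e > 0"
  obtains \<pi> x where "\<pi> \<in> borel_probs" "distr \<pi> borel fst = \<mu>\<^sub>1 \<Otimes>\<^sub>M \<mu>\<^sub>2"
    "\<And>A B. B \<in> sets borel \<Longrightarrow> measure \<pi> {z. i (fst (snd z)) \<in> A \<and> snd (snd z) \<in> B}
      = measure \<nu> {z. i (fst z) \<in> A \<and> snd z \<in> B}"
    "x \<ge> 0" "\<alpha>\<^sub>2 x \<le> ennreal (r - a)"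
    "(\<integral>\<^sup>+(x, y). ennreal ((c\<^sub>1 \<oplus>\<^sub>c c\<^sub>2) x y) \<partial>\<pi>) \<le> (\<integral>\<^sup>+(x, y). ennreal (c\<^sub>1 x y) \<partial>\<pi>\<^sub>1) + ennreal (x + e)"
proof -
  have P1: "prob_space \<mu>\<^sub>1" and s1: "sets \<mu>\<^sub>1 = sets borel"
    and P2: "prob_space \<mu>\<^sub>2" and s2: "sets \<mu>\<^sub>2 = sets borel"
    and P: "prob_space \<nu>" and s[measurable_cong]: "sets \<nu> = sets borel"
    using \<mu>1 \<mu>2 \<nu> by (auto simp: borel_probs_def)
  have sp: "space \<mu>\<^sub>1 = UNIV" "space \<mu>\<^sub>2 = UNIV" "space \<nu> = UNIV"
    using s1 s2 s sets_eq_imp_space_eq[OF s1] sets_eq_imp_space_eq[OF s2] sets_eq_imp_space_eq[OF s] by auto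
  interpret \<nu>: prob_space \<nu> by fact
  define \<nu>1 where "\<nu>1 = distr \<nu> borel fst"
  have \<nu>1_eq: "distr \<nu> \<mu>\<^sub>1 fst = \<nu>1" unfolding \<nu>1_def by (rule distr_cong) (auto simp: s1)
  have [measurable_cong]: "sets \<nu>1 = sets borel" by (simp add: \<nu>1_def)
  define cell where "cell j = {z :: 'a \<times> 'b. i (fst z) = j}" for j
  have [measurable]: "cell j \<in> sets borel" for j unfolding cell_def by measurable
  define p where "p j = measure \<nu> (cell j)" for j
  have p: "emeasure \<nu> (cell j) = ennreal (p j)" for j by (simp add: p_def \<nu>.emeasure_eq_measure)
  define J where "J = {j. p j > 0}"
  have J_range: "j \<in> range i" if "j \<in> J" for j
  proof (rule ccontr)
    assume "j \<notin> range i"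
    then have "cell j = {}" by (auto simp: cell_def)
    with that show False by (simp add: J_def p_def)
  qed
  then have J: "finite J" using fin_i by (meson finite_subset subsetI)
  have p0: "p j = 0" if "j \<notin> J" for j
    using that measure_nonneg[of \<nu> "cell j"] by (simp add: J_def p_def)
  have iJ: "AE z in \<nu>. i (fst z) \<in> J"
  proof -
    have "AE z in \<nu>. i (fst z) = j \<longrightarrow> j \<in> J" for j
    proof (cases "j \<in> J")
      case False
      then have "cell j \<in> null_sets \<nu>" using p[of j] p0[of j] by (auto simp: null_sets_def s)
      then show ?thesis by (rule AE_I') (auto simp: cell_def)
    qed simp
    then have "AE z in \<nu>. \<forall>j\<in>range i. i (fst z) = j \<longrightarrow> j \<in> J"
      by (intro AE_finite_allI[OF fin_i])
    then show ?thesis by eventually_elim auto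
  qed
  define h where "h j = (if j \<in> J then distr (uniform_measure \<nu> (cell j)) borel snd else \<mu>\<^sub>2)" for j
  have h: "prob_space (h j)" "sets (h j) = sets borel" for j
  proof -
    have "prob_space (distr (uniform_measure \<nu> (cell j)) borel snd)" if "j \<in> J"
      using that by (intro prob_space.prob_space_distr prob_space_uniform_measure)
        (auto simp: p J_def sp)
    then show "prob_space (h j)" "sets (h j) = sets borel"
      using P2 by (auto simp: h_def s2)
  qed
  then have hb: "h j \<in> borel_probs" for j by (simp add: borel_probs_def)
  have hN: "emeasure \<nu> ({x \<in> space \<mu>\<^sub>1. i x = j} \<times> B) = ennreal (p j) * emeasure (h j) B"
    if j: "j \<in> J" and B: "B \<in> sets \<mu>\<^sub>2" for j B
  proof -
    have [measurable]: "B \<in> sets borel" using B s2 by simp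
    have "emeasure (h j) B = emeasure (uniform_measure \<nu> (cell j)) {z. snd z \<in> B}"
      using j unfolding h_def
      by (simp, subst emeasure_distr) (auto simp: sp vimage_def)
    also have "\<dots> = emeasure \<nu> (cell j \<inter> {z. snd z \<in> B}) / ennreal (p j)"
      by (subst emeasure_uniform_measure) (auto simp: p s)
    also have "cell j \<inter> {z. snd z \<in> B} = {x \<in> space \<mu>\<^sub>1. i x = j} \<times> B"
      by (auto simp: cell_def sp)
    finally show ?thesis
      using j by (simp add: J_def ennreal_times_divide mult_divide_eq_ennreal mult.commute[of "ennreal (p j)"])
  qed
  have sN: "sets \<nu> = sets (\<mu>\<^sub>1 \<Otimes>\<^sub>M \<mu>\<^sub>2)" by (simp add: s sets_pair_borel[OF s1 s2])
  have i': "i \<in> \<mu>\<^sub>1 \<rightarrow>\<^sub>M count_space UNIV" by (simp add: measurable_cong_sets[OF s1 refl])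
  have rfin: "rel_entropy \<nu> (\<mu>\<^sub>1 \<Otimes>\<^sub>M \<mu>\<^sub>2) < \<infinity>" by (simp add: r)
  have pJ: "p j > 0" if "j \<in> J" for j using that by (simp add: J_def)
  have chain_cell: "rel_entropy (h j) \<mu>\<^sub>2 < \<infinity>" if "j \<in> J" for j
    by (rule entropy_chain(2)[OF P1 P2 P sN rfin i' J iJ pJ h(1) _ hN that]) (auto simp: h(2) s2)
  have chain: "rel_entropy \<nu>1 \<mu>\<^sub>1 + (\<Sum>j\<in>J. ereal (p j) * rel_entropy (h j) \<mu>\<^sub>2)
      \<le> rel_entropy \<nu> (\<mu>\<^sub>1 \<Otimes>\<^sub>M \<mu>\<^sub>2)"
    unfolding \<nu>1_eq[symmetric]
    by (rule entropy_chain(3)[OF P1 P2 P sN rfin i' J iJ pJ h(1) _ hN]) (auto simp: h(2) s2)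
  have sum_p: "(\<Sum>j\<in>J. p j) = 1"
  proof -
    have "measure \<nu> (\<Union>j\<in>J. cell j) = (\<Sum>j\<in>J. p j)"
      unfolding p_def using J by (intro \<nu>.finite_measure_finite_Union) (auto simp: disjoint_family_on_def cell_def s)
    moreover have "measure \<nu> (\<Union>j\<in>J. cell j) = 1"
      using iJ J by (intro \<nu>.prob_eq_1[THEN iffD2]) (auto simp: cell_def s)
    ultimately show ?thesis by simp
  qed
  have "\<exists>x. x \<ge> 0 \<and> transport_cost c\<^sub>2 \<mu>\<^sub>2 (h j) = ennreal x \<and> enn2ereal (\<alpha>\<^sub>2 x) \<le> rel_entropy (h j) \<mu>\<^sub>2"
    if j: "j \<in> J" for j
    by (rule transport_cost_finite[OF \<alpha>2 _ chain_cell[OF j]]) (use T2 hb in auto)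
  then obtain x where x: "\<And>j. j \<in> J \<Longrightarrow> x j \<ge> 0" "\<And>j. j \<in> J \<Longrightarrow> transport_cost c\<^sub>2 \<mu>\<^sub>2 (h j) = ennreal (x j)"
    "\<And>j. j \<in> J \<Longrightarrow> enn2ereal (\<alpha>\<^sub>2 (x j)) \<le> rel_entropy (h j) \<mu>\<^sub>2"
    by metis
  define X where "X = (\<Sum>j\<in>J. p j * x j)"
  have X0: "X \<ge> 0" unfolding X_def using x(1) pJ by (intro sum_nonneg mult_nonneg_nonneg) (auto simp: less_imp_le)
  have "ereal a + enn2ereal (\<alpha>\<^sub>2 X) \<le> ereal r"
  proof -
    have "enn2ereal (\<alpha>\<^sub>2 X) \<le> enn2ereal (\<Sum>j\<in>J. ennreal (p j) * \<alpha>\<^sub>2 (x j))"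
      unfolding X_def using class_C_Jensen[OF \<alpha>2(1) J pJ sum_p x(1)] by (simp add: less_eq_ennreal.rep_eq)
    also have "\<dots> = (\<Sum>j\<in>J. ereal (p j) * enn2ereal (\<alpha>\<^sub>2 (x j)))"
      by (subst sum_enn2ereal[symmetric]) (auto simp: times_ennreal.rep_eq pJ less_imp_le intro!: sum.cong)
    also have "\<dots> \<le> (\<Sum>j\<in>J. ereal (p j) * rel_entropy (h j) \<mu>\<^sub>2)"
      using x(3) pJ by (intro sum_mono ereal_mult_left_mono) (auto simp: less_imp_le)
    finally have "ereal a + enn2ereal (\<alpha>\<^sub>2 X)
        \<le> rel_entropy \<nu>1 \<mu>\<^sub>1 + (\<Sum>j\<in>J. ereal (p j) * rel_entropy (h j) \<mu>\<^sub>2)"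
      using a by (intro add_mono) (auto simp: \<nu>1_def)
    also have "\<dots> \<le> ereal r" using chain r by simp
    finally show ?thesis .
  qed
  then have \<alpha>X: "\<alpha>\<^sub>2 X \<le> ennreal (r - a)"
    by (cases "\<alpha>\<^sub>2 X") (auto simp: top_ereal_def intro!: ennreal_leI)
  have "\<exists>\<kappa>. \<kappa> \<in> couplings \<mu>\<^sub>2 (h j) \<and> (j \<in> J \<longrightarrow> (\<integral>\<^sup>+ (x, y). ennreal (c\<^sub>2 x y) \<partial>\<kappa>) \<le> ennreal (x j + e))" for j
  proof (cases "j \<in> J")
    case True
    with x e have "transport_cost c\<^sub>2 \<mu>\<^sub>2 (h j) \<le> ennreal (x j)" by simp
    from transport_cost_near_optimal[OF this e x(1)[OF True]] show ?thesis by metis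
  next
    case False
    with diagonal_coupling[OF \<mu>2] show ?thesis by (auto simp: h_def)
  qed
  then obtain \<kappa> where \<kappa>: "\<And>j. \<kappa> j \<in> couplings \<mu>\<^sub>2 (h j)"
    "\<And>j. j \<in> J \<Longrightarrow> (\<integral>\<^sup>+ (x, y). ennreal (c\<^sub>2 x y) \<partial>\<kappa> j) \<le> ennreal (x j + e)"
    by metis
  have \<pi>1': "\<pi>\<^sub>1 \<in> couplings \<mu>\<^sub>1 \<nu>1" using \<pi>1 by (simp add: \<nu>1_def)
  have int_i: "(\<integral>\<^sup>+y. g (i y) \<partial>\<nu>1) = (\<Sum>j\<in>J. g j * ennreal (p j))" for g :: "nat \<Rightarrow> ennreal"
  proof -
    have [measurable]: "(\<lambda>y. g (i y)) \<in> borel_measurable borel"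
      by (rule measurable_compose[OF i]) simp
    have "(\<integral>\<^sup>+y. g (i y) \<partial>\<nu>1) = (\<integral>\<^sup>+z. g (i (fst z)) \<partial>\<nu>)"
      unfolding \<nu>1_def by (rule nn_integral_distr) measurable
    also have "\<dots> = (\<integral>\<^sup>+z. (\<Sum>j\<in>J. g j * indicator (cell j) z) \<partial>\<nu>)"
    proof (rule nn_integral_cong_AE, use iJ in eventually_elim)
      case (elim z)
      have "(\<Sum>j\<in>J. g j * indicator (cell j) z) = (\<Sum>j\<in>J. if j = i (fst z) then g j else 0)"
        by (intro sum.cong) (auto simp: cell_def indicator_def)
      then show ?case using elim J by simp
    qed
    also have "\<dots> = (\<Sum>j\<in>J. \<integral>\<^sup>+z. g j * indicator (cell j) z \<partial>\<nu>)"
      by (rule nn_integral_sum) measurable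
    also have "\<dots> = (\<Sum>j\<in>J. g j * ennreal (p j))"
      by (intro sum.cong refl) (simp add: nn_integral_cmult_indicator s p)
    finally show ?thesis .
  qed
  let ?\<pi> = "glue \<pi>\<^sub>1 i \<kappa>"
  have \<pi>b: "?\<pi> \<in> borel_probs" by (rule glue_in_borel_probs[OF \<pi>1' \<kappa>(1) i])
  show thesis
  proof (rule that[of ?\<pi> X])
    show "?\<pi> \<in> borel_probs" "X \<ge> 0" "\<alpha>\<^sub>2 X \<le> ennreal (r - a)" by fact+
    show "distr ?\<pi> borel fst = \<mu>\<^sub>1 \<Otimes>\<^sub>M \<mu>\<^sub>2" by (rule glue_first_marginal[OF \<pi>1' \<kappa>(1) i])
    show "measure ?\<pi> {z. i (fst (snd z)) \<in> A \<and> snd (snd z) \<in> B} = measure \<nu> {z. i (fst z) \<in> A \<and> snd z \<in> B}"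
      if B[measurable]: "B \<in> sets borel" for A B
    proof -
      have A[measurable]: "{y. i y \<in> A} \<in> sets borel"
        using measurable_sets[OF i, of A] by (simp add: vimage_def)
      have "emeasure ?\<pi> {z. i (fst (snd z)) \<in> A \<and> snd (snd z) \<in> B}
          = (\<integral>\<^sup>+y. indicator {y. i y \<in> A} y * emeasure (h (i y)) B \<partial>\<nu>1)"
        using glue_second_marginal[OF \<pi>1' \<kappa>(1) i A B] by simp
      also have "\<dots> = (\<integral>\<^sup>+y. indicator A (i y) * emeasure (h (i y)) B \<partial>\<nu>1)"
        by (intro nn_integral_cong) (auto simp: indicator_def)
      also have "\<dots> = (\<Sum>j\<in>J. indicator A j * emeasure (h j) B * ennreal (p j))"
        by (rule int_i)
      also have "\<dots> = (\<Sum>j\<in>J. indicator A j * emeasure \<nu> {z. i (fst z) = j \<and> snd z \<in> B})"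
      proof (intro sum.cong refl)
        fix j assume j: "j \<in> J"
        have "{z. i (fst z) = j \<and> snd z \<in> B} = {x \<in> space \<mu>\<^sub>1. i x = j} \<times> B" by (auto simp: sp)
        then show "indicator A j * emeasure (h j) B * ennreal (p j)
            = indicator A j * emeasure \<nu> {z. i (fst z) = j \<and> snd z \<in> B}"
          using hN[OF j, of B] B s2 by (simp add: mult_ac)
      qed
      also have "\<dots> = (\<Sum>j\<in>J. \<integral>\<^sup>+z. indicator A j * indicator {z. i (fst z) = j \<and> snd z \<in> B} z \<partial>\<nu>)"
        by (intro sum.cong refl nn_integral_cmult_indicator[symmetric]) measurable
      also have "\<dots> = (\<integral>\<^sup>+z. (\<Sum>j\<in>J. indicator A j * indicator {z. i (fst z) = j \<and> snd z \<in> B} z) \<partial>\<nu>)"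
        by (rule nn_integral_sum[symmetric]) measurable
      also have "\<dots> = (\<integral>\<^sup>+z. indicator {z. i (fst z) \<in> A \<and> snd z \<in> B} z \<partial>\<nu>)"
      proof (rule nn_integral_cong_AE, use iJ in eventually_elim)
        case (elim z)
        have "(\<Sum>j\<in>J. indicator A j * indicator {z. i (fst z) = j \<and> snd z \<in> B} z)
            = (\<Sum>j\<in>J. if j = i (fst z) then indicator {z. i (fst z) \<in> A \<and> snd z \<in> B} z else (0::ennreal))"
          by (intro sum.cong) (auto simp: indicator_def)
        then show ?case using elim J by simp
      qed
      also have "\<dots> = emeasure \<nu> {z. i (fst z) \<in> A \<and> snd z \<in> B}"
      proof (rule nn_integral_indicator)
        have "{z. i (fst z) \<in> A \<and> snd z \<in> B} = {y. i y \<in> A} \<times> B" by auto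
        also have "\<dots> \<in> sets \<nu>" unfolding s borel_prod[symmetric] by measurable
        finally show "{z. i (fst z) \<in> A \<and> snd z \<in> B} \<in> sets \<nu>" .
      qed
      finally show ?thesis by (simp add: measure_def)
    qed
    have "(\<integral>\<^sup>+y. (\<integral>\<^sup>+(x, y). ennreal (c\<^sub>2 x y) \<partial>\<kappa> (i y)) \<partial>\<nu>1)
        = (\<Sum>j\<in>J. (\<integral>\<^sup>+(x, y). ennreal (c\<^sub>2 x y) \<partial>\<kappa> j) * ennreal (p j))"
      by (rule int_i)
    also have "\<dots> \<le> (\<Sum>j\<in>J. ennreal (x j + e) * ennreal (p j))"
      by (intro sum_mono mult_right_mono \<kappa>(2)) auto
    also have "\<dots> = ennreal (\<Sum>j\<in>J. (x j + e) * p j)"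
      using x(1) e pJ by (subst sum_ennreal[symmetric])
        (auto simp: ennreal_mult less_imp_le intro!: sum.cong mult_nonneg_nonneg add_nonneg_nonneg)
    also have "(\<Sum>j\<in>J. (x j + e) * p j) = X + e"
    proof -
      have "(\<Sum>j\<in>J. (x j + e) * p j) = (\<Sum>j\<in>J. p j * x j) + e * (\<Sum>j\<in>J. p j)"
        by (simp add: sum_distrib_left sum.distrib algebra_simps)
      then show ?thesis by (simp add: X_def sum_p)
    qed
    finally show "(\<integral>\<^sup>+(x, y). ennreal ((c\<^sub>1 \<oplus>\<^sub>c c\<^sub>2) x y) \<partial>?\<pi>)
        \<le> (\<integral>\<^sup>+(x, y). ennreal (c\<^sub>1 x y) \<partial>\<pi>\<^sub>1) + ennreal (X + e)"
      unfolding glue_cost[OF \<pi>1' \<kappa>(1) i c1 c10 c2 c20] by (rule add_left_mono)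
  qed
qed

section \<open>Refining partitions and tensorization\<close>

text \<open>
  The cells of the finite partition generated by \<open>U 0, \<dots>, U (m - 1)\<close>, numbered by encoding the set of
  indices \<open>k < m\<close> with \<open>x \<in> U k\<close> as a natural number.
\<close>

definition cell_index :: "(nat \<Rightarrow> 'a set) \<Rightarrow> nat \<Rightarrow> 'a \<Rightarrow> nat" where
  "cell_index U m x = set_encode {k. k < m \<and> x \<in> U k}"

lemma decode_cell_index: "set_decode (cell_index U m x) = {k. k < m \<and> x \<in> U k}"
  by (simp add: cell_index_def)

lemma finite_range_cell_index: "finite (range (cell_index U m))"
proof (rule finite_subset)
  show "range (cell_index U m) \<subseteq> set_encode ` Pow {..<m}"
    by (auto simp: cell_index_def)
qed simp

lemma cell_index_measurable:
  assumes [measurable]: "\<And>k. U k \<in> sets M" and sp: "space M = UNIV"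
  shows "cell_index U m \<in> M \<rightarrow>\<^sub>M count_space UNIV"
proof (subst measurable_count_space_eq_countable[OF countableI_type], intro conjI ballI)
  fix j
  have "cell_index U m x = j \<longleftrightarrow> (\<forall>k. (k < m \<and> x \<in> U k) \<longleftrightarrow> k \<in> set_decode j)" for x
  proof
    show "cell_index U m x = j \<Longrightarrow> \<forall>k. (k < m \<and> x \<in> U k) \<longleftrightarrow> k \<in> set_decode j"
      using decode_cell_index[of U m x] by auto
    assume "\<forall>k. (k < m \<and> x \<in> U k) \<longleftrightarrow> k \<in> set_decode j"
    then have "{k. k < m \<and> x \<in> U k} = set_decode j" by auto
    then show "cell_index U m x = j" by (simp add: cell_index_def)
  qed
  then have "cell_index U m -` {j} \<inter> space M
      = {x\<in>space M. \<forall>k. (k < m \<and> x \<in> U k) \<longleftrightarrow> k \<in> set_decode j}" by auto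
  also have "\<dots> \<in> sets M" by measurable
  finally show "cell_index U m -` {j} \<inter> space M \<in> sets M" .
qed simp

lemma countable_basis_sequence:
  obtains U :: "nat \<Rightarrow> 'a::second_countable_topology set" where "topological_basis (range U)"
proof -
  obtain B :: "'a set set" where B: "countable B" "topological_basis B"
    using ex_countable_basis by blast
  then have "B \<noteq> {}" by (meson UNIV_I empty_iff open_UNIV topological_basisE)
  with B show thesis by (intro that[of "from_nat_into B"]) (simp add: range_from_nat_into)
qed

definition rectangle :: "(nat \<Rightarrow> 'a set) \<Rightarrow> (nat \<Rightarrow> 'b set) \<Rightarrow> nat \<Rightarrow> ('a \<times> 'b) set" where
  "rectangle U W k = U (fst (prod_decode k)) \<times> W (snd (prod_decode k))"

lemma rectangle_basis:
  assumes "topological_basis (range U)" "topological_basis (range W)"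
  shows "topological_basis (range (rectangle U W))"
proof -
  have "range (rectangle U W) = (\<lambda>(a, b). a \<times> b) ` (range U \<times> range W)"
  proof (intro equalityI subsetI)
    fix R assume "R \<in> (\<lambda>(a, b). a \<times> b) ` (range U \<times> range W)"
    then obtain a b where "R = U a \<times> W b" by auto
    then have "R = rectangle U W (prod_encode (a, b))" by (simp add: rectangle_def)
    then show "R \<in> range (rectangle U W)" by blast
  qed (auto simp: rectangle_def)
  with topological_basis_prod[OF assms] show ?thesis by simp
qed

text \<open>
  If one of the two functions vanishes identically, so does the inf-convolution, and the claim is
  nonnegativity of entropy. Otherwise both grow to infinity, all relevant transport costs are finite, and
  the couplings adapted to finer and finer partitions can be passed to the limit.
\<close>

theorem theorem4p2:
  fixes \<mu>\<^sub>1 :: "'a::polish_space measure" and \<mu>\<^sub>2 :: "'b::polish_space measure"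
    and c\<^sub>1 :: "'a \<Rightarrow> 'a \<Rightarrow> real" and c\<^sub>2 :: "'b \<Rightarrow> 'b \<Rightarrow> real"
    and \<alpha>\<^sub>1 \<alpha>\<^sub>2 :: "real \<Rightarrow> ennreal"
  assumes "\<mu>\<^sub>1 \<in> borel_probs" and "\<mu>\<^sub>2 \<in> borel_probs"
    and "continuous_on UNIV (\<lambda>(x, y). c\<^sub>1 x y)" and "\<And>x y. c\<^sub>1 x y \<ge> 0" and "\<And>x. c\<^sub>1 x x = 0"
    and "continuous_on UNIV (\<lambda>(x, y). c\<^sub>2 x y)" and "\<And>x y. c\<^sub>2 x y \<ge> 0" and "\<And>x. c\<^sub>2 x x = 0"
    and "\<alpha>\<^sub>1 \<in> class_C" and "\<alpha>\<^sub>2 \<in> class_C"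
    and "\<forall>\<nu>\<^sub>1\<in>borel_probs.
      enn2ereal (extend_infty \<alpha>\<^sub>1 (transport_cost c\<^sub>1 \<mu>\<^sub>1 \<nu>\<^sub>1)) \<le> rel_entropy \<nu>\<^sub>1 \<mu>\<^sub>1"
    and "\<forall>\<nu>\<^sub>2\<in>borel_probs.
      enn2ereal (extend_infty \<alpha>\<^sub>2 (transport_cost c\<^sub>2 \<mu>\<^sub>2 \<nu>\<^sub>2)) \<le> rel_entropy \<nu>\<^sub>2 \<mu>\<^sub>2"
  shows "\<forall>\<nu>\<in>borel_probs.
    enn2ereal (extend_infty (\<alpha>\<^sub>1 \<box> \<alpha>\<^sub>2) (transport_cost (c\<^sub>1 \<oplus>\<^sub>c c\<^sub>2) (\<mu>\<^sub>1 \<Otimes>\<^sub>M \<mu>\<^sub>2) \<nu>))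
      \<le> rel_entropy \<nu> (\<mu>\<^sub>1 \<Otimes>\<^sub>M \<mu>\<^sub>2)"
proof
  fix \<nu> :: "('a \<times> 'b) measure" assume \<nu>: "\<nu> \<in> borel_probs"
  note \<mu>1 = assms(1) and \<mu>2 = assms(2) and \<alpha>1 = assms(9) and \<alpha>2 = assms(10)
  let ?c = "c\<^sub>1 \<oplus>\<^sub>c c\<^sub>2" and ?\<mu> = "\<mu>\<^sub>1 \<Otimes>\<^sub>M \<mu>\<^sub>2"
  have P1: "prob_space \<mu>\<^sub>1" and s1: "sets \<mu>\<^sub>1 = sets borel"
    and P2: "prob_space \<mu>\<^sub>2" and s2: "sets \<mu>\<^sub>2 = sets borel"
    and P: "prob_space \<nu>" and s[measurable_cong]: "sets \<nu> = sets borel"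
    using \<mu>1 \<mu>2 \<nu> by (auto simp: borel_probs_def)
  have s\<mu>: "sets ?\<mu> = sets borel" by (rule sets_pair_borel[OF s1 s2])
  have P\<mu>: "prob_space ?\<mu>" by (rule prob_space_pair[OF P1 P2])
  have sN: "sets \<nu> = sets ?\<mu>" by (simp add: s s\<mu>)
  have cm: "(\<lambda>(x, y). c\<^sub>1 x y) \<in> borel_measurable borel" "(\<lambda>(x, y). c\<^sub>2 x y) \<in> borel_measurable borel"
    using assms(3,6) by (auto intro: borel_measurable_continuous_onI)
  show "enn2ereal (extend_infty (\<alpha>\<^sub>1 \<box> \<alpha>\<^sub>2) (transport_cost ?c ?\<mu> \<nu>)) \<le> rel_entropy \<nu> ?\<mu>"
  proof (cases "rel_entropy \<nu> ?\<mu> < \<infinity>")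
    case True
    note fin = True
    have nonneg: "0 \<le> rel_entropy \<nu> ?\<mu>" by (rule rel_entropy_nonneg[OF P\<mu> P sN])
    then obtain r where r: "rel_entropy \<nu> ?\<mu> = ereal r" using fin by (cases "rel_entropy \<nu> ?\<mu>") auto
    show ?thesis
    proof (cases "(\<exists>t\<ge>0. \<alpha>\<^sub>1 t \<noteq> 0) \<and> (\<exists>t\<ge>0. \<alpha>\<^sub>2 t \<noteq> 0)")
      case False
      have "(\<alpha>\<^sub>1 \<box> \<alpha>\<^sub>2) t = 0" if t: "t \<ge> 0" for t
      proof -
        have "(\<alpha>\<^sub>1 \<box> \<alpha>\<^sub>2) t \<le> \<alpha>\<^sub>1 t + \<alpha>\<^sub>2 0" "(\<alpha>\<^sub>1 \<box> \<alpha>\<^sub>2) t \<le> \<alpha>\<^sub>1 0 + \<alpha>\<^sub>2 t"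
          using t by (auto intro!: inf_convolution_le[OF \<alpha>1 \<alpha>2])
        then show ?thesis using False t by (auto simp: class_C_props(2)[OF \<alpha>1] class_C_props(2)[OF \<alpha>2])
      qed
      then show ?thesis using nonneg by (simp add: extend_infty_eq_0 zero_ennreal.rep_eq)
    next
      case True
      then obtain u1 u2 where u1: "u1 \<ge> 0" "\<alpha>\<^sub>1 u1 \<noteq> 0" and u2: "u2 \<ge> 0" "\<alpha>\<^sub>2 u2 \<noteq> 0" by blast
      define \<nu>1 where "\<nu>1 = distr \<nu> borel fst"
      have \<nu>1: "\<nu>1 \<in> borel_probs"
        unfolding borel_probs_def \<nu>1_def by (auto intro!: prob_space.prob_space_distr P)
      have "distr \<nu> \<mu>\<^sub>1 fst = \<nu>1" unfolding \<nu>1_def by (rule distr_cong) (auto simp: s1)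
      then have H1: "rel_entropy \<nu>1 \<mu>\<^sub>1 \<le> ereal r"
        using rel_entropy_fst_marginal_le[OF P1 P2 P sN fin] r by simp
      then have "rel_entropy \<nu>1 \<mu>\<^sub>1 < \<infinity>" by auto
      then obtain t1 where t1: "t1 \<ge> 0" "transport_cost c\<^sub>1 \<mu>\<^sub>1 \<nu>1 = ennreal t1"
        "enn2ereal (\<alpha>\<^sub>1 t1) \<le> rel_entropy \<nu>1 \<mu>\<^sub>1"
        using transport_cost_finite[OF \<alpha>1 u1] assms(11) \<nu>1 by metis
      with H1 have "enn2ereal (\<alpha>\<^sub>1 t1) \<le> ereal r" by simp
      then obtain a where a: "\<alpha>\<^sub>1 t1 = ennreal a" "0 \<le> a" "a \<le> r"
        by (cases "\<alpha>\<^sub>1 t1") (auto simp: top_ereal_def)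
      with t1 have aH: "ereal a \<le> rel_entropy (distr \<nu> borel fst) \<mu>\<^sub>1" by (simp add: \<nu>1_def)
      \<comment> \<open>\<open>S\<close> bounds the average second cost for every partition at once.\<close>
      obtain S where S: "S \<ge> 0" "\<alpha>\<^sub>2 S \<le> ennreal (r - a)"
        "\<And>s. s \<ge> 0 \<Longrightarrow> \<alpha>\<^sub>2 s \<le> ennreal (r - a) \<Longrightarrow> s \<le> S"
        using class_C_sublevel_Sup[OF \<alpha>2 u2, of "r - a"] by blast
      obtain U :: "nat \<Rightarrow> 'a set" where U: "topological_basis (range U)" by (rule countable_basis_sequence)
      obtain W :: "nat \<Rightarrow> 'b set" where W: "topological_basis (range W)" by (rule countable_basis_sequence)
      have [measurable]: "U k \<in> sets borel" "W k \<in> sets borel" for k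
        using topological_basis_open[OF U, of "U k"] topological_basis_open[OF W, of "W k"] by auto
      let ?V = "rectangle U W"
      have bound: "transport_cost ?c ?\<mu> \<nu> \<le> ennreal (t1 + S) + ennreal e" if e: "e > 0" for e
      proof -
        obtain \<pi>\<^sub>1 where \<pi>1: "\<pi>\<^sub>1 \<in> couplings \<mu>\<^sub>1 (distr \<nu> borel fst)"
          "(\<integral>\<^sup>+ (x, y). ennreal (c\<^sub>1 x y) \<partial>\<pi>\<^sub>1) \<le> ennreal (t1 + e / 2)"
          using transport_cost_near_optimal[of c\<^sub>1 \<mu>\<^sub>1 \<nu>1 t1 "e / 2"] t1 e
          unfolding \<nu>1_def by auto
        define Q where "Q m \<pi> \<longleftrightarrow> \<pi> \<in> borel_probs \<and> distr \<pi> borel fst = ?\<mu> \<and>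
            (\<forall>A. \<forall>B\<in>sets borel. measure \<pi> {z. cell_index U m (fst (snd z)) \<in> A \<and> snd (snd z) \<in> B}
              = measure \<nu> {z. cell_index U m (fst z) \<in> A \<and> snd z \<in> B}) \<and>
            (\<integral>\<^sup>+(x, y). ennreal (?c x y) \<partial>\<pi>) \<le> ennreal (t1 + S + e)" for m \<pi>
        have "\<exists>\<pi>. Q m \<pi>" for m
        proof -
          obtain \<pi> x where \<pi>: "\<pi> \<in> borel_probs" "distr \<pi> borel fst = ?\<mu>"
            "\<And>A B. B \<in> sets borel \<Longrightarrow> measure \<pi> {z. cell_index U m (fst (snd z)) \<in> A \<and> snd (snd z) \<in> B}
              = measure \<nu> {z. cell_index U m (fst z) \<in> A \<and> snd z \<in> B}"
            and x: "x \<ge> 0" "\<alpha>\<^sub>2 x \<le> ennreal (r - a)"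
            and cost: "(\<integral>\<^sup>+(x, y). ennreal (?c x y) \<partial>\<pi>)
              \<le> (\<integral>\<^sup>+(x, y). ennreal (c\<^sub>1 x y) \<partial>\<pi>\<^sub>1) + ennreal (x + e / 2)"
            by (rule cellwise_coupling[OF \<mu>1 \<mu>2 \<nu> cm(1) assms(4) cm(2) assms(7) \<alpha>2 u2 assms(12) r aH
                  cell_index_measurable[where U = U and m = m] finite_range_cell_index \<pi>1(1), where e = "e / 2"])
               (use e in auto)
          have "(\<integral>\<^sup>+(x, y). ennreal (?c x y) \<partial>\<pi>) \<le> ennreal (t1 + e / 2) + ennreal (S + e / 2)"
            using cost \<pi>1(2) S(3)[OF x] by (elim order.trans) (intro add_mono ennreal_leI, auto)
          also have "\<dots> = ennreal (t1 + S + e)"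
            using t1(1) S(1) e by (subst ennreal_plus[symmetric]) (auto simp: algebra_simps)
          finally show ?thesis using \<pi> unfolding Q_def by blast
        qed
        then obtain \<pi> where "\<And>m. Q m (\<pi> m)" by metis
        then have \<pi>: "\<And>m. \<pi> m \<in> borel_probs" "\<And>m. distr (\<pi> m) borel fst = ?\<mu>"
          "\<And>m A B. B \<in> sets borel \<Longrightarrow> measure (\<pi> m) {z. cell_index U m (fst (snd z)) \<in> A \<and> snd (snd z) \<in> B}
              = measure \<nu> {z. cell_index U m (fst z) \<in> A \<and> snd z \<in> B}"
          "\<And>m. (\<integral>\<^sup>+(x, y). ennreal (?c x y) \<partial>\<pi> m) \<le> ennreal (t1 + S + e)"
          by (simp_all add: Q_def)
        have "\<exists>\<rho>\<in>couplings ?\<mu> \<nu>. (\<integral>\<^sup>+(x, y). ennreal (?c x y) \<partial>\<rho>) \<le> ennreal (t1 + S + e)"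
        proof (rule coupling_limit[OF rectangle_basis[OF U W] _ \<nu> \<pi>(1) _ _ _ _ \<pi>(4)])
          show "?\<mu> \<in> borel_probs" using P\<mu> s\<mu> by (simp add: borel_probs_def)
          fix J :: "nat set" assume J: "finite J"
          have Vb[measurable]: "?V k \<in> sets borel" for k
            unfolding rectangle_def borel_prod[symmetric] by measurable
          have "measure (\<pi> m) {z. \<forall>k\<in>J. fst z \<in> ?V k} = measure ?\<mu> {x. \<forall>k\<in>J. x \<in> ?V k}" for m
          proof -
            have \<pi>s[measurable_cong]: "sets (\<pi> m) = sets borel" using \<pi>(1) by (simp add: borel_probs_def)
            have "space (\<pi> m) = UNIV" using sets_eq_imp_space_eq[OF \<pi>s] by simp
            moreover have "{x. \<forall>k\<in>J. x \<in> ?V k} \<in> sets borel"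
            proof -
              have "{x\<in>space borel. \<forall>k\<in>J. x \<in> ?V k} \<in> sets borel" using J by measurable
              then show ?thesis by simp
            qed
            ultimately show ?thesis
              unfolding \<pi>(2)[of m, symmetric] by (subst measure_distr) (auto simp: vimage_def)
          qed
          then show "(\<lambda>m. measure (\<pi> m) {z. \<forall>k\<in>J. fst z \<in> ?V k}) \<longlonglongrightarrow> measure ?\<mu> {x. \<forall>k\<in>J. x \<in> ?V k}"
            by simp
          define B where "B = {y. \<forall>k\<in>J. y \<in> W (snd (prod_decode k))}"
          have B: "B \<in> sets borel"
          proof -
            have "{y\<in>space borel. \<forall>k\<in>J. y \<in> W (snd (prod_decode k))} \<in> sets borel" using J by measurable
            then show ?thesis by (simp add: B_def)
          qed
          \<comment> \<open>Once \<open>m\<close> exceeds the indices of the first factors, their intersection is a union of cells, namely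
              of those with index in \<open>A\<close>; from then on the measures agree exactly.\<close>
          define A where "A = {j. \<forall>k\<in>J. fst (prod_decode k) \<in> set_decode j}"
          obtain m0 where m0: "\<And>k. k \<in> J \<Longrightarrow> fst (prod_decode k) < m0"
            using J finite_nat_set_iff_bounded[of "(\<lambda>k. fst (prod_decode k)) ` J"] by auto
          have "measure (\<pi> m) {z. \<forall>k\<in>J. snd z \<in> ?V k} = measure \<nu> {x. \<forall>k\<in>J. x \<in> ?V k}"
            if "m \<ge> m0" for m
          proof -
            have A_eq: "cell_index U m x \<in> A \<longleftrightarrow> (\<forall>k\<in>J. x \<in> U (fst (prod_decode k)))" for x
              using m0 that by (fastforce simp: A_def decode_cell_index)
            have "{z :: ('a \<times> 'b) \<times> ('a \<times> 'b). \<forall>k\<in>J. snd z \<in> ?V k} = {z. cell_index U m (fst (snd z)) \<in> A \<and> snd (snd z) \<in> B}"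
              "{x. \<forall>k\<in>J. x \<in> ?V k} = {z. cell_index U m (fst z) \<in> A \<and> snd z \<in> B}"
              unfolding A_eq by (auto simp: rectangle_def B_def mem_Times_iff)
            then show ?thesis using \<pi>(3)[OF B, of m A] by simp
          qed
          then have "\<forall>\<^sub>F m in sequentially. measure (\<pi> m) {z. \<forall>k\<in>J. snd z \<in> ?V k} = measure \<nu> {x. \<forall>k\<in>J. x \<in> ?V k}"
            by (rule eventually_mono[OF eventually_ge_at_top[of m0]])
          then show "(\<lambda>m. measure (\<pi> m) {z. \<forall>k\<in>J. snd z \<in> ?V k}) \<longlonglongrightarrow> measure \<nu> {x. \<forall>k\<in>J. x \<in> ?V k}"
            by (rule tendsto_eventually)
        next
          show "continuous_on UNIV (\<lambda>(x, y). ?c x y)"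
          proof -
            have "continuous_on UNIV (\<lambda>z. c\<^sub>1 (fst (fst z)) (fst (snd z)))"
              using continuous_on_compose2[OF assms(3), of UNIV "\<lambda>z. (fst (fst z), fst (snd z))"]
              by (simp add: continuous_intros)
            moreover have "continuous_on UNIV (\<lambda>z. c\<^sub>2 (snd (fst z)) (snd (snd z)))"
              using continuous_on_compose2[OF assms(6), of UNIV "\<lambda>z. (snd (fst z), snd (snd z))"]
              by (simp add: continuous_intros)
            ultimately show ?thesis
              unfolding cost_sum_def case_prod_beta' by (rule continuous_on_add)
          qed
          show "0 \<le> ?c x y" for x y by (simp add: cost_sum_def assms)
        qed
        then have "transport_cost ?c ?\<mu> \<nu> \<le> ennreal (t1 + S + e)"
          unfolding transport_cost_def by (blast intro: INF_lower2)
        then show ?thesis using t1(1) S(1) e by (simp add: ennreal_plus[symmetric] del: ennreal_plus)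
      qed
      then have "transport_cost ?c ?\<mu> \<nu> \<le> ennreal (t1 + S)" by (rule ennreal_le_epsilon)
      then obtain t where t: "t \<ge> 0" "transport_cost ?c ?\<mu> \<nu> = ennreal t" "t \<le> t1 + S"
        using t1(1) S(1) by (cases "transport_cost ?c ?\<mu> \<nu>")
          (auto simp: top_unique ennreal_plus[symmetric] simp del: ennreal_plus)
      have "extend_infty (\<alpha>\<^sub>1 \<box> \<alpha>\<^sub>2) (transport_cost ?c ?\<mu> \<nu>) = (\<alpha>\<^sub>1 \<box> \<alpha>\<^sub>2) t"
        using t by (simp add: extend_infty_def)
      also have "\<dots> \<le> \<alpha>\<^sub>1 t1 + \<alpha>\<^sub>2 S"
        by (rule inf_convolution_le[OF \<alpha>1 \<alpha>2 t(1) t1(1) S(1) t(3)])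
      also have "\<dots> \<le> ennreal a + ennreal (r - a)" using a S(2) by (intro add_mono) auto
      also have "\<dots> = ennreal r" using a by (simp add: ennreal_plus[symmetric] del: ennreal_plus)
      finally have "enn2ereal (extend_infty (\<alpha>\<^sub>1 \<box> \<alpha>\<^sub>2) (transport_cost ?c ?\<mu> \<nu>)) \<le> enn2ereal (ennreal r)"
        by (simp only: less_eq_ennreal.rep_eq)
      then show ?thesis using a r by simp
    qed
  qed auto
qed

end
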